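(* Let $F,G,I,S,j_a,j_b,a_e,b_o$ be as in the context, where $F(x)=x^{n+1}+\sum_{k=0}^{n}b_kx^k$ and $G(x)=-Ax^m-\sum_{k=0}^{m-1}a_kx^k$ satisfy $F(0)=F'(0)=0$, $F'(x)/x>0$ for all $x\in\mathbb R$, $G(0)=0$, $G(x)/x<0$ for all $x\in\mathbb R$, and at least one of $j_a$ and $j_b$ is well-defined. Assume that $m<2n+1$. Then the following statements hold. 1. Suppose that $n-2j_b<m-2j_a$ or $a_e=0$. (a) If $m-n-2j_b-1<0$ and $b_{2j_b+1}(m-n+2j_b+1)>0$ (resp. $b_{2j_b+1}(m-n+2j_b+1)<0$), then $I(y)\to-\infty$ (resp. $I(y)\to+\infty$) as $y\to+\infty$, and, for each $y_0$ sufficiently large, the orbit $U=\{y_l\mid l\in\mathbb N\}$ of $y_0$ by $S$ (resp. by $S^{-1}$) tends (monotonically) to $+\infty$, $U$ is Minkowski nondegenerate and $\dim_B U=\frac{n-2j_b}{n+1-2j_b}$. (b) If $m-n-2j_b-1>0$, then $I(y)$ converges to a real number $I_*$ as $y\to+\infty$. When $I_*<0$ (resp. $I_*>0$), for each $y_0$ sufficiently large the orbit $U$ of $y_0$ by $S$ (resp. $S^{-1}$) tends to $+\infty$, $U$ is Minkowski nondegenerate and $\dim_B U=\frac{2n+1-m}{2n+2-m}$. When $I_*=0$, for each $y_0$ sufficiently large the orbit $U$ of $y_0$ by $S$ (resp. $S^{-1}$) tends to $+\infty$ for $b_{2j_b+1}<0$ (resp. $b_{2j_b+1}>0$), $U$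 is Minkowski nondegenerate and $\dim_B U=\frac{n-2j_b}{n+1-2j_b}$. 2. Suppose that $n-2j_b>m-2j_a$ or $b_o=0$. (a) If $2m-2n-2j_a-1<0$ and $a_{2j_a}<0$ (resp. $a_{2j_a}>0$), then $I(y)\to-\infty$ (resp. $I(y)\to+\infty$) as $y\to+\infty$, and, for each $y_0$ sufficiently large, the orbit $U$ of $y_0$ by $S$ (resp. $S^{-1}$) tends to $+\infty$, $U$ is Minkowski nondegenerate and $\dim_B U=\frac{m-2j_a}{m+1-2j_a}$. (b) If $2m-2n-2j_a-1>0$, then $I(y)$ converges to a real number $I_*$ as $y\to+\infty$. When $I_*<0$ (resp. $I_*>0$), for each $y_0$ sufficiently large the orbit $U$ of $y_0$ by $S$ (resp. $S^{-1}$) tends to $+\infty$, $U$ is Minkowski nondegenerate and $\dim_B U=\frac{2n+1-m}{2n+2-m}$. If $I_*=0$, then for each $y_0$ sufficiently large the orbit $U$ of $y_0$ by $S$ (resp. $S^{-1}$) tends to $+\infty$ for $a_{2j_a}>0$ (resp. $a_{2j_a}<0$), $U$ is Minkowski nondegenerate and $\dim_B U=\frac{m-2j_a}{m+1-2j_a}$. 3. Suppose that $n-2j_b=m-2j_a$ and $C:=b_{2j_b+1}(m-n+2j_b+1)-a_{2j_a}(n+1)\neq0$. (a) If $m-n-2j_b-1<0$ and $C>0$ (resp. $C<0$), then $I(y)\to-\infty$ (resp. $I(y)\to+\infty$) as $y\to+\infty$, and, for each $y_0$ sufficiently large, the orbit $U$ of $y_0$ by $S$ (resp. $S^{-1}$)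 tends (monotonically) to $+\infty$, $U$ is Minkowski nondegenerate and $\dim_B U=\frac{n-2j_b}{n+1-2j_b}$. (b) If $m-n-2j_b-1>0$, then $I(y)$ converges to a real number $I_*$ as $y\to+\infty$. When $I_*<0$ (resp. $I_*>0$), for each $y_0$ sufficiently large the orbit $U$ of $y_0$ by $S$ (resp. $S^{-1}$) tends to $+\infty$, $U$ is Minkowski nondegenerate and $\dim_B U=\frac{2n+1-m}{2n+2-m}$. When $I_*=0$, for each $y_0$ sufficiently large the orbit $U$ of $y_0$ by $S$ (resp. $S^{-1}$) tends to $+\infty$ for $C<0$ (resp. $C>0$), $U$ is Minkowski nondegenerate and $\dim_B U=\frac{n-2j_b}{n+1-2j_b}$.
   Context: Setting. Consider the slow-fast Liénard system $\dot x=y-F(x)$, $\dot y=\epsilon G(x)$, $0\le\epsilon\ll1$, where $F(x)=x^{n+1}+\sum_{k=0}^{n}b_kx^k$ and $G(x)=-Ax^m-\sum_{k=0}^{m-1}a_kx^k$ are real polynomials, $m,n\ge1$ integers. The normalization is: $A=1$ if $m$ is even and $m\neq 2n+1$; $A\in\{-1,1\}$ if $m$ is odd and $m\ne 2n+1$; $A\neq0$ if $m=2n+1$. The assumptions $F(0)=F'(0)=0$, $F'(x)/x>0$ for all $x\in\mathbb R$, $G(0)=0$, $G(x)/x<0$ for all $x\in\mathbb R$ are understood with $F'(x)/x$ and $G(x)/x$ regarded as polynomials (so also at $x=0$, i.e. $F''(0)>0$, $G'(0)<0$). They imply that $m$ and $n$ are odd, $b_0=b_1=a_0=0$, $A>0$;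 thus $A=1$ when $m\neq2n+1$. Slow divergence integrals. For $y>0$ let $\omega(y)>0$ and $\alpha(y)<0$ be the unique numbers with $F(\omega(y))=F(\alpha(y))=y$ (and $\omega(0)=\alpha(0)=0$). Put $$I_-(y)=-\int_{\omega(y)}^{0}\frac{F'(x)^2}{G(x)}\,dx,\qquad I_+(y)=-\int_{\alpha(y)}^{0}\frac{F'(x)^2}{G(x)}\,dx,\qquad I(y)=I_-(y)-I_+(y).$$ The functions $I_\pm$ are strictly decreasing with $I_\pm(0)=0$, and, for $m\le 2n+1$, $I_\pm(y)\to-\infty$ as $y\to+\infty$. Slow relation function. $S:[0,\infty)\to[0,\infty)$ is defined by $I_-(y)=I_+(S(y))$, and $S^{-1}$ is its inverse. The orbit of $y_0>0$ by $S$ is $U=\{y_l=S^l(y_0)\mid l\in\mathbb N\}$ ($S^l$ the $l$-fold composition); the orbit by $S^{-1}$ is defined in the same way with $S^{-1}$ in place of $S$. "$U$ tends to $+\infty$" means $y_l\to+\infty$ as $l\to\infty$. "For each $y_0$ sufficiently large" means: there is $M>0$ such that the assertion holds for every $y_0>M$. Coefficients. If some odd-index coefficient $b_{2j+1}$ ($0\le j\le\frac{n-1}{2}$) of $F$ is nonzero, $j_b$ is the maximal $j$ with $b_{2j+1}\neq0$; otherwise $j_b$ is not defined and we write $b_o=0$. If some even-index coefficient $a_{2j}$ ($0\le j\le\frac{m-1}{2}$) is nonzero, $j_a$ is the maximal $j$ with $a_{2j}\neq0$; otherwise $j_a$ is not defined and we write $a_e=0$. A condition comparing $n-2j_b$ with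 $m-2j_a$ presupposes that both $j_a$ and $j_b$ are defined. Minkowski dimension. For bounded $V\subset\mathbb R$ and $\delta>0$ let $V_\delta=\{x\in\mathbb R\mid d(x,V)\le\delta\}$ with Lebesgue measure $|V_\delta|$. For $s\ge0$ put $\mathcal M_*^s(V)=\liminf_{\delta\to0}|V_\delta|/\delta^{1-s}$ and $\mathcal M^{*s}(V)=\limsup_{\delta\to0}|V_\delta|/\delta^{1-s}$. The lower and upper Minkowski dimensions are $\underline{\dim}_BV=\inf\{s\ge0\mid\mathcal M_*^s(V)=0\}$, $\overline{\dim}_BV=\inf\{s\ge0\mid\mathcal M^{*s}(V)=0\}$; if equal, the common value is $\dim_BV$. $V$ is Minkowski nondegenerate if $0<\mathcal M_*^d(V)\le\mathcal M^{*d}(V)<\infty$ for some $d$ (then $d=\dim_BV$). For an orbit $U=\{y_l\}$ with $y_l\to+\infty$ and $m\le2n+1$, the lower and upper Minkowski dimensions of $U$ are by definition those of the bounded set $\{y_l^{-1/(n+1)}\mid l\in\mathbb N\}$, $\dim_BU$ is their common value when they agree, and $U$ is called Minkowski nondegenerate if $\{y_l^{-1/(n+1)}\mid l\in\mathbb N\}$ is. *)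

theory Defs
  imports "HOL-Analysis.Analysis" "HOL-Computational_Algebra.Polynomial"
begin

section \<open>The slow-fast Lienard system\<close>

definition lienard_F :: "nat \<Rightarrow> (nat \<Rightarrow> real) \<Rightarrow> real poly" where
  "lienard_F n b = monom 1 (n + 1) + (\<Sum>k\<le>n. monom (b k) k)"

definition lienard_G :: "nat \<Rightarrow> real \<Rightarrow> (nat \<Rightarrow> real) \<Rightarrow> real poly" where
  "lienard_G m A a = - monom A m - (\<Sum>k<m. monom (a k) k)"

definition lienard_normalized :: "nat \<Rightarrow> nat \<Rightarrow> real \<Rightarrow> bool" where
  "lienard_normalized m n A \<longleftrightarrow>
     (even m \<and> m \<noteq> 2 * n + 1 \<longrightarrow> A = 1) \<and>
     (odd m \<and> m \<noteq> 2 * n + 1 \<longrightarrow> A \<in> {-1, 1}) \<and>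
     (m = 2 * n + 1 \<longrightarrow> A \<noteq> 0)"

text \<open>The quotients \<open>F'(x)/x\<close> and \<open>G(x)/x\<close> are polynomials (the divisions below are
  exact because \<open>F'(0) = G(0) = 0\<close>), so the sign conditions also constrain \<open>x = 0\<close>.\<close>

definition lienard_admissible :: "real poly \<Rightarrow> real poly \<Rightarrow> bool" where
  "lienard_admissible F G \<longleftrightarrow>
     poly F 0 = 0 \<and> poly (pderiv F) 0 = 0 \<and> (\<forall>x. poly (pderiv F div [:0, 1:]) x > 0) \<and>
     poly G 0 = 0 \<and> (\<forall>x. poly (G div [:0, 1:]) x < 0)"

text \<open>The numbers \<open>j\<^sub>b\<close> and \<open>j\<^sub>a\<close> are the maxima of the following finite sets; they are
  defined exactly when the set is nonempty.\<close>

definition odd_indices :: "nat \<Rightarrow> (nat \<Rightarrow> real) \<Rightarrow> nat set" where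
  "odd_indices n b = {j. 2 * j + 1 \<le> n \<and> b (2 * j + 1) \<noteq> 0}"

definition even_indices :: "nat \<Rightarrow> (nat \<Rightarrow> real) \<Rightarrow> nat set" where
  "even_indices m a = {j. 2 * j + 1 \<le> m \<and> a (2 * j) \<noteq> 0}"

section \<open>Slow divergence integrals and the slow relation function\<close>

definition omega :: "real poly \<Rightarrow> real \<Rightarrow> real" where
  "omega F y = (if y = 0 then 0 else (THE x. x > 0 \<and> poly F x = y))"

definition alpha :: "real poly \<Rightarrow> real \<Rightarrow> real" where
  "alpha F y = (if y = 0 then 0 else (THE x. x < 0 \<and> poly F x = y))"

text \<open>The integrals are oriented. The integrand has a removable singularity at \<open>x = 0\<close>.\<close>

definition I_minus :: "real poly \<Rightarrow> real poly \<Rightarrow> real \<Rightarrow> real" where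
  "I_minus F G y = - (LBINT x=ereal (omega F y)..0. (poly (pderiv F) x)\<^sup>2 / poly G x)"

definition I_plus :: "real poly \<Rightarrow> real poly \<Rightarrow> real \<Rightarrow> real" where
  "I_plus F G y = - (LBINT x=ereal (alpha F y)..0. (poly (pderiv F) x)\<^sup>2 / poly G x)"

definition slow_div_integral :: "real poly \<Rightarrow> real poly \<Rightarrow> real \<Rightarrow> real" where
  "slow_div_integral F G y = I_minus F G y - I_plus F G y"

definition slow_relation :: "real poly \<Rightarrow> real poly \<Rightarrow> real \<Rightarrow> real" where
  "slow_relation F G y = (THE z. z \<ge> 0 \<and> I_minus F G y = I_plus F G z)"

definition slow_relation_inv :: "real poly \<Rightarrow> real poly \<Rightarrow> real \<Rightarrow> real" where
  "slow_relation_inv F G = inv_into {0..} (slow_relation F G)"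

definition orbit :: "(real \<Rightarrow> real) \<Rightarrow> real \<Rightarrow> nat \<Rightarrow> real" where
  "orbit T y0 l = (T ^^ l) y0"

section \<open>Minkowski dimension\<close>

definition nbhd :: "real set \<Rightarrow> real \<Rightarrow> real set" where
  "nbhd V \<delta> = {x. infdist x V \<le> \<delta>}"

definition lower_Minkowski_content :: "real \<Rightarrow> real set \<Rightarrow> ennreal" where
  "lower_Minkowski_content s V =
     Liminf (at_right 0) (\<lambda>\<delta>. emeasure lebesgue (nbhd V \<delta>) / ennreal (\<delta> powr (1 - s)))"

definition upper_Minkowski_content :: "real \<Rightarrow> real set \<Rightarrow> ennreal" where
  "upper_Minkowski_content s V =
     Limsup (at_right 0) (\<lambda>\<delta>. emeasure lebesgue (nbhd V \<delta>) / ennreal (\<delta> powr (1 - s)))"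

text \<open>For bounded \<open>V\<close> both sets contain every \<open>s > 1\<close>, so the infima are proper.\<close>

definition lower_Minkowski_dim :: "real set \<Rightarrow> real" where
  "lower_Minkowski_dim V = Inf {s. s \<ge> 0 \<and> lower_Minkowski_content s V = 0}"

definition upper_Minkowski_dim :: "real set \<Rightarrow> real" where
  "upper_Minkowski_dim V = Inf {s. s \<ge> 0 \<and> upper_Minkowski_content s V = 0}"

definition has_Minkowski_dim :: "real set \<Rightarrow> real \<Rightarrow> bool" where
  "has_Minkowski_dim V d \<longleftrightarrow> lower_Minkowski_dim V = d \<and> upper_Minkowski_dim V = d"

definition Minkowski_nondegenerate :: "real set \<Rightarrow> bool" where
  "Minkowski_nondegenerate V \<longleftrightarrow>
     (\<exists>d\<ge>0. 0 < lower_Minkowski_content d V \<and>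
            lower_Minkowski_content d V \<le> upper_Minkowski_content d V \<and>
            upper_Minkowski_content d V < \<infinity>)"

text \<open>Dimension and nondegeneracy of an orbit \<open>U\<close> tending to infinity are those of the
  bounded set \<open>{y\<^sup>-\<^sup>1\<^sup>/\<^sup>(\<^sup>n\<^sup>+\<^sup>1\<^sup>) | y \<in> U}\<close>.\<close>

definition compactified :: "nat \<Rightarrow> real set \<Rightarrow> real set" where
  "compactified n U = (\<lambda>y. y powr (- 1 / real (n + 1))) ` U"

definition orbit_dim_at_infinity :: "nat \<Rightarrow> (real \<Rightarrow> real) \<Rightarrow> real \<Rightarrow> real \<Rightarrow> bool" where
  "orbit_dim_at_infinity n T y0 d \<longleftrightarrow>
     filterlim (orbit T y0) at_top sequentially \<and>
     Minkowski_nondegenerate (compactified n (range (orbit T y0))) \<and>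
     has_Minkowski_dim (compactified n (range (orbit T y0))) d"

definition large_orbits :: "nat \<Rightarrow> (real \<Rightarrow> real) \<Rightarrow> real \<Rightarrow> bool" where
  "large_orbits n T d \<longleftrightarrow> (\<exists>M>0. \<forall>y0>M. orbit_dim_at_infinity n T y0 d)"

definition large_orbits_mono :: "nat \<Rightarrow> (real \<Rightarrow> real) \<Rightarrow> real \<Rightarrow> bool" where
  "large_orbits_mono n T d \<longleftrightarrow>
     (\<exists>M>0. \<forall>y0>M. incseq (orbit T y0) \<and> orbit_dim_at_infinity n T y0 d)"

end

theory Submission imports Defs "HOL-Real_Asymp.Real_Asymp" begin

text \<open>
  Put \<open>u = y\<^sup>1\<^sup>/\<^sup>(\<^sup>n\<^sup>+\<^sup>1\<^sup>)\<close>. Since \<open>dI\<^sub>-/dy = h(\<omega>(y))\<close> and \<open>dI\<^sub>+/dy = h(\<alpha>(y))\<close> for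
  \<open>h = F'/G\<close>, the derivative of \<open>I\<close> only sees the parts of \<open>F\<close> and \<open>G\<close> that break the symmetry
  \<open>x \<mapsto> -x\<close>. If the leading ones among them are smaller by a factor of order \<open>u\<^sup>-\<^sup>k\<close> than the leading
  terms, then \<open>dI/du\<close> is asymptotic to a constant times \<open>u\<^sup>p\<^sup>-\<^sup>k\<^sup>-\<^sup>1\<close> with \<open>p = 2n + 1 - m\<close>, whereas
  \<open>dI\<^sub>\<plusminus>/du\<close> is of order \<open>u\<^sup>p\<^sup>-\<^sup>1\<close>. Integrating, \<open>I\<close> is of order \<open>u\<^sup>p\<^sup>-\<^sup>k\<close> up to the limit \<open>I\<^sub>*\<close>, so one
  step of the slow relation moves \<open>u\<close> by an amount of order \<open>u\<^sup>1\<^sup>-\<^sup>k\<close> (of order \<open>u\<^sup>1\<^sup>-\<^sup>p\<close> if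
  \<open>I\<^sub>* \<noteq> 0\<close>). Hence the gaps of the sequence \<open>r = 1/u\<close> are of order \<open>r\<^sup>k\<^sup>+\<^sup>1\<close>, which gives the
  dimension \<open>k/(k+1)\<close>.
\<close>

section \<open>Minkowski content of slowly decreasing sequences\<close>

text \<open>Nondegeneracy only asks for neighbourhoods of the right order of magnitude, so every
  estimate is a pair of bounds with unspecified constants; no expansion of \<open>I\<close> or of an
  orbit is computed.

  The exponent p - k never vanishes: n and m are odd, so p is even, while k = n - 2 j_b or k = m - 2
  j_a is odd. Hence no logarithm appears between cases (a) and (b).

  The factor of b comes from two effects of an odd term b x^(n+1-k) of F. It displaces
  \<open>omega\<close> against \<open>- alpha\<close>, which through the derivative of h contributes
  m - n, and it enters F' in h directly, which contributes n + 1 - k. The sum is m + 1 - k, that is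
  m - n + 2 j_b + 1 for k = n - 2 j_b. An even term of G leaves \<open>omega\<close> and
  \<open>alpha\<close> in place and enters h directly, with factor n + 1. When both kinds of terms
  have the same order k, the two contributions add up to the constant \<open>C\<close>.\<close>

lemma Minkowski_of_power_bounds:
  assumes A: "0 < A" and d: "0 \<le> d" and \<delta>0: "0 < \<delta>0"
    and lo: "\<And>\<delta>. 0 < \<delta> \<Longrightarrow> \<delta> < \<delta>0 \<Longrightarrow>
      ennreal (A * \<delta> powr (1 - d)) \<le> emeasure lebesgue (nbhd V \<delta>)"
    and up: "\<And>\<delta>. 0 < \<delta> \<Longrightarrow> \<delta> < \<delta>0 \<Longrightarrow>
      emeasure lebesgue (nbhd V \<delta>) \<le> ennreal (B * \<delta> powr (1 - d))"
  shows "Minkowski_nondegenerate V" "has_Minkowski_dim V d"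
proof -
  define f where "f s \<delta> = emeasure lebesgue (nbhd V \<delta>) / ennreal (\<delta> powr (1 - s))" for s \<delta>
  have small: "eventually (\<lambda>\<delta>. 0 < \<delta> \<and> \<delta> < min 1 \<delta>0) (at_right 0)"
    unfolding eventually_at_right_field using \<delta>0 by (intro exI[of _ "min 1 \<delta>0"]) auto
  \<comment> \<open>The sign of \<open>B\<close> is not assumed. Since \<open>ennreal\<close> sends
    negative reals to 0, the positive lower bound at \<open>\<delta>0/2\<close> forces it.\<close>
  have B: "0 \<le> B"
  proof -
    have "ennreal (A * (\<delta>0/2) powr (1 - d)) \<le> ennreal (B * (\<delta>0/2) powr (1 - d))"
      using lo[of "\<delta>0/2"] up[of "\<delta>0/2"] \<delta>0 by (auto intro: order_trans)
    moreover have "0 < A * (\<delta>0/2) powr (1 - d)" using A \<delta>0 by auto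
    ultimately have "0 < B * (\<delta>0/2) powr (1 - d)"
      by (metis ennreal_eq_0_iff leD le_zero_eq linorder_not_less)
    thus ?thesis using \<delta>0 by (simp add: zero_less_mult_iff)
  qed
  have ratio: "ennreal (c * \<delta> powr (1 - d)) / ennreal (\<delta> powr (1 - s)) = ennreal (c * \<delta> powr (s - d))"
    if "0 < \<delta>" "0 \<le> c" for c \<delta> s :: real
    using that by (subst divide_ennreal) (auto simp: powr_diff)
  have lower: "ennreal A \<le> lower_Minkowski_content s V" if "s \<le> d" for s
    unfolding lower_Minkowski_content_def f_def[symmetric]
  proof (rule Liminf_bounded, rule eventually_mono[OF small])
    fix \<delta> :: real assume \<delta>: "0 < \<delta> \<and> \<delta> < min 1 \<delta>0"
    have "1 \<le> \<delta> powr (s - d)" using \<delta> that powr_mono'[of "s-d" 0 \<delta>] by simp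
    hence "ennreal A \<le> ennreal (A * \<delta> powr (s - d))" using A by (intro ennreal_leI) simp
    also have "\<dots> = ennreal (A * \<delta> powr (1 - d)) / ennreal (\<delta> powr (1 - s))"
      using ratio \<delta> A by simp
    also have "\<dots> \<le> f s \<delta>" unfolding f_def using lo \<delta> by (intro divide_right_mono_ennreal) auto
    finally show "ennreal A \<le> f s \<delta>" .
  qed
  have fle: "eventually (\<lambda>\<delta>. f s \<delta> \<le> ennreal (B * \<delta> powr (s - d))) (at_right 0)" for s
  proof (rule eventually_mono[OF small])
    fix \<delta> :: real assume \<delta>: "0 < \<delta> \<and> \<delta> < min 1 \<delta>0"
    have "f s \<delta> \<le> ennreal (B * \<delta> powr (1 - d)) / ennreal (\<delta> powr (1 - s))"
      unfolding f_def using up \<delta> by (intro divide_right_mono_ennreal) auto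
    thus "f s \<delta> \<le> ennreal (B * \<delta> powr (s - d))" using ratio \<delta> B by simp
  qed
  have upper: "upper_Minkowski_content d V \<le> ennreal B"
    unfolding upper_Minkowski_content_def f_def[symmetric]
    by (rule Limsup_bounded, rule eventually_mono[OF eventually_conj[OF fle[of d] small]])
       auto
  have upper0: "upper_Minkowski_content s V = 0" if "s > d" for s
  proof -
    have "((\<lambda>\<delta>. \<delta> powr (s - d)) \<longlongrightarrow> 0) (at_right (0::real))"
      using that by real_asymp
    hence "((\<lambda>\<delta>. ennreal (B * \<delta> powr (s - d))) \<longlongrightarrow> ennreal (B * 0)) (at_right 0)"
      by (intro tendsto_ennrealI tendsto_mult tendsto_const)
    hence "Limsup (at_right 0) (\<lambda>\<delta>. ennreal (B * \<delta> powr (s - d))) = 0"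
      by (intro lim_imp_Limsup) auto
    hence "Limsup (at_right 0) (f s) \<le> 0" using Limsup_mono[OF fle[of s]] by simp
    thus ?thesis unfolding upper_Minkowski_content_def f_def by simp
  qed
  have le: "lower_Minkowski_content s V \<le> upper_Minkowski_content s V" for s
    unfolding lower_Minkowski_content_def upper_Minkowski_content_def
    by (rule Liminf_le_Limsup) simp
  show "Minkowski_nondegenerate V"
    unfolding Minkowski_nondegenerate_def
    using d A lower[of d] upper le[of d]
    by (intro exI[of _ d]) (auto simp: less_top intro: less_le_trans[of 0 "ennreal A"] le_less_trans)
  have pos: "0 < lower_Minkowski_content s V" if "s \<le> d" for s
    using lower[OF that] A by (auto intro: less_le_trans[of 0 "ennreal A"])
  have lz: "lower_Minkowski_content s V = 0 \<longleftrightarrow> d < s" for s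
    using pos[of s] upper0[of s] le[of s] by (cases "d < s") auto
  have uz: "upper_Minkowski_content s V = 0 \<longleftrightarrow> d < s" for s
    using upper0[of s] less_le_trans[OF pos le, of s] by (cases "d < s") auto
  \<comment> \<open>The quotient has order \<open>\<delta> powr (s - d)\<close>, so both contents
    vanish exactly for s > d; as d is nonnegative, the constraint on s cuts nothing off.\<close>
  have "{s. s \<ge> 0 \<and> lower_Minkowski_content s V = 0} = {d<..}"
    "{s. s \<ge> 0 \<and> upper_Minkowski_content s V = 0} = {d<..}"
    unfolding lz uz using d by auto
  thus "has_Minkowski_dim V d"
    unfolding has_Minkowski_dim_def lower_Minkowski_dim_def upper_Minkowski_dim_def by simp
qed

lemma closed_nbhd: "closed (nbhd V \<delta>)"
  unfolding nbhd_def by (intro closed_Collect_le continuous_intros)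

text \<open>The scale t of order \<open>\<delta> powr (1/(k+1))\<close> separates two regimes. Below
  t the gaps of 1/u are at most \<open>\<delta>\<close>, so the neighbourhood contains (0,t). Above
  t there are at most of order t^(-k) points, each costing a multiple of \<open>\<delta>\<close>; as
  t^(k+1) is of order \<open>\<delta>\<close>, their total is again of order t.\<close>

lemma Minkowski_reciprocals:
  fixes u :: "nat \<Rightarrow> real"
  assumes k: "1 \<le> k" and c: "0 < c1" and u1: "\<And>l. 1 \<le> u l"
    and lo: "\<And>l. c1 \<le> (u (Suc l) - u l) * u l ^ (k - 1)"
    and up: "\<And>l. (u (Suc l) - u l) * u l ^ (k - 1) \<le> c2"
  shows "filterlim u at_top sequentially"
    and "Minkowski_nondegenerate (range (\<lambda>l. 1 / u l))"
    and "has_Minkowski_dim (range (\<lambda>l. 1 / u l)) (real k / (real k + 1))"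
proof -
  define V where "V = range (\<lambda>l. 1 / u l)"
  obtain k' where k': "k = Suc k'" using k by (cases k) auto
  have c2: "0 < c2" using lo[of 0] up[of 0] c by linarith
  have mono: "u l < u (Suc l)" for l
    using lo[of l] c u1[of l] by (smt (verit) mult_nonpos_nonneg zero_le_power)
  \<comment> \<open>Discrete form of (u^k)' >= u^(k-1) u': bounding u_(l+1)^k below by u_(l+1)
    u_l^(k-1) shows that each step adds at least \<open>c1\<close>.\<close>
  have grow: "c1 * l \<le> u l ^ k" for l
  proof (induction l)
    case 0 thus ?case using u1[of 0] by simp
  next
    case (Suc l)
    have "u l ^ k + (u (Suc l) - u l) * u l ^ (k - 1) = u (Suc l) * u l ^ (k - 1)"
      by (simp add: k' algebra_simps)
    also have "\<dots> \<le> u (Suc l) ^ k"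
      using mono[of l] u1[of l] by (simp add: k' mult_left_mono power_mono)
    finally show ?case using Suc lo[of l] by (simp add: algebra_simps)
  qed
  have "filterlim (\<lambda>l. c1 * real l) at_top sequentially" using c by real_asymp
  hence pow: "filterlim (\<lambda>l. u l ^ k) at_top sequentially"
    by (rule filterlim_at_top_mono) (use grow in auto)
  show lim: "filterlim u at_top sequentially"
    unfolding filterlim_at_top
  proof
    fix Z :: real
    have "eventually (\<lambda>l. \<bar>Z\<bar> ^ k \<le> u l ^ k) sequentially"
      using pow unfolding filterlim_at_top by blast
    thus "eventually (\<lambda>l. Z \<le> u l) sequentially"
    proof eventually_elim
      case (elim l)
      hence "\<bar>Z\<bar> \<le> u l" using u1[of l] k power_mono_iff[of "\<bar>Z\<bar>" "u l" k] by simp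
      thus ?case by simp
    qed
  qed
  \<comment> \<open>Consecutive terms differ by at most the factor \<open>R\<close>, which lets a
    gap be bounded through its smaller endpoint; in \<open>lower\<close> only that endpoint is known
    to lie below the scale t.\<close>
  define R where "R = 1 + c2"
  have R: "R > 1" using c2 by (simp add: R_def)
  have ratio: "u (Suc l) \<le> R * u l" for l
  proof -
    have "u (Suc l) - u l \<le> (u (Suc l) - u l) * u l ^ (k - 1)"
      using mult_left_mono[OF one_le_power[OF u1[of l], of "k - 1"], of "u (Suc l) - u l"] mono[of l]
      by simp
    hence "u (Suc l) - u l \<le> c2 * 1" using up[of l] by simp
    also have "\<dots> \<le> c2 * u l" using c2 u1[of l] by (intro mult_left_mono) auto
    finally show ?thesis by (simp add: R_def algebra_simps)
  qed
  have gap: "1 / u l - 1 / u (Suc l) \<le> c2 * R ^ k * (1 / u (Suc l)) ^ (k + 1)" for l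
  proof -
    have pos: "0 < u l" "0 < u (Suc l)" using u1[of l] u1[of "Suc l"] by linarith+
    have "1 / u l - 1 / u (Suc l) = ((u (Suc l) - u l) * u l ^ (k - 1)) / (u l ^ k * u (Suc l))"
      using pos by (simp add: k' divide_simps)
    also have "\<dots> \<le> c2 / (u l ^ k * u (Suc l))"
      using pos up[of l] by (intro divide_right_mono) auto
    also have "\<dots> \<le> c2 / ((u (Suc l) / R) ^ k * u (Suc l))"
    proof (intro divide_left_mono mult_right_mono power_mono)
      show "u (Suc l) / R \<le> u l" using ratio[of l] R by (simp add: field_simps)
    qed (use pos R c2 in \<open>auto intro!: mult_pos_pos\<close>)
    also have "\<dots> = c2 * R ^ k * (1 / u (Suc l)) ^ (k + 1)"
      using pos R by (simp add: field_simps power_divide)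
    finally show ?thesis .
  qed
  define K where "K = c2 * R ^ k"
  have K: "K > 0" using c2 R by (simp add: K_def)
  define d where "d = real k / (real k + 1)"
  have d1: "1 - d = 1 / real (k + 1)" by (simp add: d_def field_simps)
  have rt: "(x powr (1 - d)) ^ (k + 1) = x" if "0 < x" for x :: real
    unfolding d1 using that powr_powr[of x "1 / real (k + 1)" "real (k + 1)"]
    by (subst powr_realpow[symmetric]) (auto simp del: of_nat_add)
  \<comment> \<open>The second entry keeps t below 1 / u 0, the largest point, so that each x in
    (0,t) lies between two consecutive points. The first entry gives \<open>\<delta> \<le> t\<close>
    in \<open>upper\<close>.\<close>
  define \<delta>0 where "\<delta>0 = min 1 (K * (1 / u 0) ^ (k + 1))"
  have \<delta>0: "\<delta>0 > 0" using K u1[of 0] by (simp add: \<delta>0_def)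
  have lower: "ennreal ((1 / K) powr (1 - d) * \<delta> powr (1 - d)) \<le> emeasure lebesgue (nbhd V \<delta>)"
    if \<delta>: "0 < \<delta>" "\<delta> < \<delta>0" for \<delta>
  proof -
    define t where "t = (\<delta> / K) powr (1 - d)"
    have t: "0 < t" "t ^ (k + 1) = \<delta> / K" using \<delta> K rt by (auto simp: t_def)
    have t0: "t < 1 / u 0"
    proof (rule power_less_imp_less_base[of _ "k + 1"])
      show "t ^ (k + 1) < (1 / u 0) ^ (k + 1)" unfolding t(2) using \<delta> K
        by (simp add: \<delta>0_def field_simps)
    qed (use u1[of 0] in simp)
    have "{0<..<t} \<subseteq> nbhd V \<delta>"
    proof
      fix x assume "x \<in> {0<..<t}"
      hence x: "0 < x" "x < t" by auto
      have "\<exists>l. 1 / x \<le> u l" 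
        using lim unfolding filterlim_at_top eventually_sequentially by blast
      then obtain j where j: "1 / x \<le> u j" "\<And>i. i < j \<Longrightarrow> \<not> 1 / x \<le> u i"
        using exists_least_iff[of "\<lambda>l. 1 / x \<le> u l"] by blast
      have "j \<noteq> 0"
      proof
        assume "j = 0"
        with j have "1 / u 0 \<le> x" using x u1[of 0] by (simp add: field_simps)
        thus False using x t0 by simp
      qed
      then obtain l where l: "j = Suc l" by (cases j) auto
      have pos: "0 < u l" "0 < u j" using u1[of l] u1[of j] by linarith+
      have x1: "1 / u j \<le> x" using j(1) pos x by (simp add: field_simps)
      have x2: "x < 1 / u l" using j(2)[of l] pos x l by (simp add: field_simps)
      have "dist x (1 / u j) \<le> 1 / u l - 1 / u (Suc l)"
        using x1 x2 by (simp add: dist_real_def l)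
      also have "\<dots> \<le> K * (1 / u j) ^ (k + 1)" using gap[of l] by (simp add: K_def l)
      also have "\<dots> \<le> K * t ^ (k + 1)"
        using K x x1 pos by (intro mult_left_mono power_mono) auto
      also have "\<dots> = \<delta>" using t K by simp
      finally have "dist x (1 / u j) \<le> \<delta>" .
      moreover have "infdist x V \<le> dist x (1 / u j)" by (rule infdist_le) (simp add: V_def)
      ultimately show "x \<in> nbhd V \<delta>" by (simp add: nbhd_def)
    qed
    hence "emeasure lebesgue {0<..<t} \<le> emeasure lebesgue (nbhd V \<delta>)"
      by (intro emeasure_mono) (use closed_nbhd in auto)
    moreover have "t = (1 / K) powr (1 - d) * \<delta> powr (1 - d)"
      using \<delta> K by (simp add: t_def powr_divide)
    ultimately show ?thesis using t by simp
  qed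
  \<comment> \<open>The interval near 0 costs t + 4 \<open>\<delta>\<close>, rounding
    \<open>N\<close> up costs another 4 \<open>\<delta>\<close>, and the remaining intervals cost 4
    t / c1; \<open>\<delta> \<le> t\<close> gives 9 + 4 / c1.\<close>
  have upper: "emeasure lebesgue (nbhd V \<delta>) \<le> ennreal ((9 + 4 / c1) * \<delta> powr (1 - d))"
    if \<delta>: "0 < \<delta>" "\<delta> < \<delta>0" for \<delta>
  proof -
    define t where "t = \<delta> powr (1 - d)"
    have t: "0 < t" "t ^ (k + 1) = \<delta>" using \<delta> rt by (auto simp: t_def)
    have \<delta>t: "\<delta> \<le> t"
    proof -
      have "\<delta> \<le> 1" using \<delta> by (simp add: \<delta>0_def)
      hence "t powr 1 \<ge> \<delta>" unfolding t_def using \<delta> powr_mono'[of "1-d" 1 \<delta>]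
        by (simp add: d_def)
      thus ?thesis using t by simp
    qed
    define X where "X = (1 / t) ^ k"
    have X: "0 \<le> X / c1" "X * \<delta> = t"
      using t c unfolding X_def t(2)[symmetric] by (auto simp: power_divide)
    define N where "N = nat \<lceil>X / c1\<rceil>"
    \<comment> \<open>The radius is doubled because the infimum in \<open>infdist\<close> need not
      be attained: distance at most \<open>\<delta>\<close> to the set only yields a point closer
      than 2 \<open>\<delta>\<close>.\<close>
    define W where "W = (\<Union>l<N. {1 / u l - 2 * \<delta>..1 / u l + 2 * \<delta>})"
    have "nbhd V \<delta> \<subseteq> {- 2 * \<delta>..t + 2 * \<delta>} \<union> W"
    proof
      fix x assume "x \<in> nbhd V \<delta>"
      hence "infdist x V < 2 * \<delta>" using \<delta> by (simp add: nbhd_def)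
      hence "(INF a\<in>V. dist x a) < 2 * \<delta>" by (simp add: infdist_def V_def)
      then obtain v where "v \<in> V" "dist x v < 2 * \<delta>"
        by (subst (asm) cINF_less_iff) (auto simp: V_def)
      then obtain l where l: "dist x (1 / u l) < 2 * \<delta>" by (auto simp: V_def)
      have pos: "0 < u l" using u1[of l] by linarith
      show "x \<in> {- 2 * \<delta>..t + 2 * \<delta>} \<union> W"
      proof (cases "1 / u l \<le> t")
        case True
        moreover have "0 < 1 / u l" using pos by simp
        ultimately have "x \<in> {- 2 * \<delta>..t + 2 * \<delta>}"
          using l unfolding dist_real_def atLeastAtMost_iff by linarith
        thus ?thesis by blast
      next
        case False
        hence "u l < 1 / t" using pos t by (simp add: field_simps)
        hence "u l ^ k < X" unfolding X_def using pos k by (intro power_strict_mono) auto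
        hence "c1 * l < X" using grow[of l] by linarith
        hence "l < X / c1" using c by (simp add: field_simps)
        hence "l < N" unfolding N_def by linarith
        moreover have "x \<in> {1 / u l - 2 * \<delta>..1 / u l + 2 * \<delta>}"
          using l unfolding dist_real_def atLeastAtMost_iff by linarith
        ultimately show ?thesis by (auto simp: W_def)
      qed
    qed
    hence "emeasure lebesgue (nbhd V \<delta>) \<le> emeasure lebesgue ({- 2 * \<delta>..t + 2 * \<delta>} \<union> W)"
      by (intro emeasure_mono) (auto simp: W_def)
    also have "\<dots> \<le> emeasure lebesgue {- 2 * \<delta>..t + 2 * \<delta>} + emeasure lebesgue W"
      by (intro emeasure_subadditive) (auto simp: W_def)
    also have "emeasure lebesgue W \<le> (\<Sum>l<N. emeasure lebesgue {1 / u l - 2 * \<delta>..1 / u l + 2 * \<delta>})"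
      unfolding W_def by (intro emeasure_subadditive_finite) auto
    also have "\<dots> = (\<Sum>l<N. ennreal (4 * \<delta>))"
      using \<delta> by (intro sum.cong) auto
    also have "\<dots> = ennreal (N * (4 * \<delta>))"
      using \<delta> by (simp add: ennreal_mult ennreal_of_nat_eq_real_of_nat)
    also have "emeasure lebesgue {- 2 * \<delta>..t + 2 * \<delta>} = ennreal (t + 4 * \<delta>)"
      using \<delta> t by simp
    also have "ennreal (t + 4 * \<delta>) + ennreal (N * (4 * \<delta>)) = ennreal (t + 4 * \<delta> + N * (4 * \<delta>))"
      using \<delta> t by (intro ennreal_plus[symmetric]) auto
    also have "\<dots> \<le> ennreal ((9 + 4 / c1) * t)"
    proof (rule ennreal_leI)
      have "real N \<le> X / c1 + 1" using X(1) unfolding N_def by linarith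
      hence "N * (4 * \<delta>) \<le> (X / c1 + 1) * (4 * \<delta>)"
        using \<delta> by (intro mult_right_mono) auto
      also have "\<dots> = 4 * (X * \<delta>) / c1 + 4 * \<delta>"
        by (simp add: field_simps)
      finally have "N * (4 * \<delta>) \<le> 4 * t / c1 + 4 * \<delta>" unfolding X(2) .
      hence "t + 4 * \<delta> + N * (4 * \<delta>) \<le> t + 8 * t + 4 * t / c1" using \<delta>t by linarith
      thus "t + 4 * \<delta> + N * (4 * \<delta>) \<le> (9 + 4 / c1) * t" by (simp add: algebra_simps)
    qed
    finally show ?thesis by (simp add: t_def add_left_mono)
  qed
  have A: "0 < (1 / K) powr (1 - d)" using K by simp
  have d0: "0 \<le> d" by (simp add: d_def)
  show "Minkowski_nondegenerate (range (\<lambda>l. 1 / u l))"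
    using Minkowski_of_power_bounds(1)[OF A d0 \<delta>0 lower upper] by (simp add: V_def)
  show "has_Minkowski_dim (range (\<lambda>l. 1 / u l)) (real k / (real k + 1))"
    using Minkowski_of_power_bounds(2)[OF A d0 \<delta>0 lower upper] by (simp add: V_def d_def)
qed

section \<open>Antiderivatives of power-like functions\<close>

text \<open>Eventually \<open>W'\<close> lies between c/2 and 2c times u^(q-1), so \<open>W\<close>
  minus the corresponding multiple of u^q / q is monotone. Dividing by q with its sign serves growth
  (q > 0) and decay (q < 0) at once.\<close>

lemma increment_power_bounds:
  fixes W W' :: "real \<Rightarrow> real"
  assumes der: "\<And>u. 0 < u \<Longrightarrow> (W has_real_derivative W' u) (at u)"
    and lim: "((\<lambda>u. W' u * u powr (1 - q)) \<longlongrightarrow> c) at_top" and c: "0 < c" and q: "q \<noteq> 0"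
  obtains u0 where "1 \<le> u0"
    "\<And>v u. u0 \<le> v \<Longrightarrow> v \<le> u \<Longrightarrow> c / (2 * q) * (u powr q - v powr q) \<le> W u - W v"
    "\<And>v u. u0 \<le> v \<Longrightarrow> v \<le> u \<Longrightarrow> W u - W v \<le> 2 * c / q * (u powr q - v powr q)"
proof -
  have "eventually (\<lambda>u. c / 2 < W' u * u powr (1 - q) \<and> W' u * u powr (1 - q) < 2 * c) at_top"
    using c by (intro eventually_conj order_tendstoD[OF lim]) auto
  then obtain u1 where u1: "\<And>u. u1 \<le> u \<Longrightarrow>
      c / 2 < W' u * u powr (1 - q) \<and> W' u * u powr (1 - q) < 2 * c"
    unfolding eventually_at_top_linorder by blast
  define u0 where "u0 = max 1 u1"
  have bound: "c / 2 * u powr (q - 1) \<le> W' u" "W' u \<le> 2 * c * u powr (q - 1)" if "u0 \<le> u" for u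
  proof -
    have u: "0 < u" "u1 \<le> u" using that by (auto simp: u0_def)
    have "W' u = (W' u * u powr (1 - q)) * u powr (q - 1)"
      using u by (simp flip: powr_add)
    moreover have "c / 2 * u powr (q - 1) \<le> (W' u * u powr (1 - q)) * u powr (q - 1)"
      "(W' u * u powr (1 - q)) * u powr (q - 1) \<le> 2 * c * u powr (q - 1)"
      using u1[OF u(2)] by (intro mult_right_mono; simp)+
    ultimately show "c / 2 * u powr (q - 1) \<le> W' u" "W' u \<le> 2 * c * u powr (q - 1)" by linarith+
  qed
  have der_diff: "((\<lambda>u. W u - a / q * u powr q) has_real_derivative W' u - a * u powr (q - 1)) (at u)"
    if "u0 \<le> u" for u a
    using that q by (auto intro!: derivative_eq_intros der simp: u0_def powr_diff field_simps)
  show ?thesis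
  proof
    show "1 \<le> u0" by (simp add: u0_def)
    fix v u assume vu: "u0 \<le> v" "v \<le> u"
    have "W v - (c / 2) / q * v powr q \<le> W u - (c / 2) / q * u powr q"
      by (rule DERIV_nonneg_imp_nondecreasing[OF vu(2)])
         (rule exI, rule conjI, rule der_diff, use bound vu in auto)
    thus "c / (2 * q) * (u powr q - v powr q) \<le> W u - W v"
      by (simp add: algebra_simps diff_divide_distrib)
    have "W u - (2 * c) / q * u powr q \<le> W v - (2 * c) / q * v powr q"
      by (rule DERIV_nonpos_imp_nonincreasing[OF vu(2)])
         (rule exI, rule conjI, rule der_diff, use bound vu in auto)
    thus "W u - W v \<le> 2 * c / q * (u powr q - v powr q)"
      by (simp add: algebra_simps diff_divide_distrib)
  qed
qed

lemma antiderivative_growth: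
  fixes W W' :: "real \<Rightarrow> real"
  assumes der: "\<And>u. 0 < u \<Longrightarrow> (W has_real_derivative W' u) (at u)"
    and lim: "((\<lambda>u. W' u * u powr (1 - q)) \<longlongrightarrow> c) at_top" and c: "0 < c" and q: "0 < q"
  shows "\<exists>c1>0. \<exists>c2. eventually (\<lambda>u. c1 * u powr q \<le> W u \<and> W u \<le> c2 * u powr q) at_top"
proof -
  from q have "q \<noteq> 0" by simp
  from increment_power_bounds[OF der lim c this] obtain u0 where u0: "1 \<le> u0"
    "\<And>u. u0 \<le> u \<Longrightarrow> c / (2 * q) * (u powr q - u0 powr q) \<le> W u - W u0"
    "\<And>u. u0 \<le> u \<Longrightarrow> W u - W u0 \<le> 2 * c / q * (u powr q - u0 powr q)"
    by (metis order_refl)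
  \<comment> \<open>With this unit the increment bounds read 2a and 8a; the slack to a and 9a
    absorbs the constants at \<open>u0\<close>, which u^q eventually dominates.\<close>
  define a where "a = c / (4 * q)"
  have a: "0 < a" "c / (2 * q) = 2 * a" "2 * c / q = 8 * a"
    using c q by (auto simp: a_def field_simps)
  have big: "eventually (\<lambda>u::real. x \<le> a * u powr q) at_top" for x
  proof -
    have "filterlim (\<lambda>u::real. a * u powr q) at_top at_top" using q a by real_asymp
    thus ?thesis unfolding filterlim_at_top by blast
  qed
  have "eventually (\<lambda>u. a * u powr q \<le> W u \<and> W u \<le> 9 * a * u powr q) at_top"
    using eventually_ge_at_top[of u0] big[of "- (W u0 - 2 * a * u0 powr q)"] big[of "W u0"]
  proof eventually_elim
    case (elim u)
    have "0 \<le> a * u0 powr q" using a by simp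
    thus ?case using elim u0(2)[of u] u0(3)[of u] unfolding a(2,3) by (simp add: algebra_simps)
  qed
  thus ?thesis using a by blast
qed

text \<open>For q < 0 the increment bounds make \<open>W\<close> eventually increasing and bounded,
  so it tends to its supremum \<open>L\<close>. Letting u tend to infinity in the increment from v
  to u bounds the tail at v.\<close>

lemma antiderivative_tail:
  fixes W W' :: "real \<Rightarrow> real"
  assumes der: "\<And>u. 0 < u \<Longrightarrow> (W has_real_derivative W' u) (at u)"
    and lim: "((\<lambda>u. W' u * u powr (1 - q)) \<longlongrightarrow> c) at_top" and c: "0 < c" and q: "q < 0"
  shows "\<exists>L. (W \<longlongrightarrow> L) at_top \<and> (\<exists>c1>0. \<exists>c2. eventually (\<lambda>u. c1 * u powr q \<le> L - W u \<and> L - W u \<le> c2 * u powr q) at_top)"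
proof -
  from q have "q \<noteq> 0" by simp
  from increment_power_bounds[OF der lim c this] obtain u0 where u0: "1 \<le> u0"
    and lo: "\<And>v u. u0 \<le> v \<Longrightarrow> v \<le> u \<Longrightarrow> c / (2 * q) * (u powr q - v powr q) \<le> W u - W v"
    and up: "\<And>v u. u0 \<le> v \<Longrightarrow> v \<le> u \<Longrightarrow> W u - W v \<le> 2 * c / q * (u powr q - v powr q)"
    by metis
  have mono: "W v \<le> W u" if "u0 \<le> v" "v \<le> u" for v u
  proof -
    have "u powr q \<le> v powr q" using that u0 q by (intro powr_mono2') auto
    hence "0 \<le> c / (2 * q) * (u powr q - v powr q)"
      using c q by (intro mult_nonpos_nonpos) (auto simp: divide_nonneg_neg)
    thus ?thesis using lo[OF that] by simp
  qed
  have bdd: "W u \<le> W u0 - 2 * c / q * u0 powr q" if "u0 \<le> u" for u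
  proof -
    have "2 * c / q * u powr q \<le> 0" using c q by (simp add: divide_nonneg_neg mult_nonpos_nonneg)
    thus ?thesis using up[OF order_refl that] by (simp add: algebra_simps diff_divide_distrib)
  qed
  define L where "L = (SUP u\<in>{u0..}. W u)"
  have bd: "bdd_above (W ` {u0..})" using bdd by (auto simp: bdd_above_def)
  have L: "(W \<longlongrightarrow> L) at_top"
  proof (rule order_tendstoI)
    fix a assume "a < L"
    then obtain v where v: "v \<ge> u0" "a < W v" unfolding L_def using bd by (subst (asm) less_cSUP_iff) auto
    show "eventually (\<lambda>u. a < W u) at_top"
      using eventually_ge_at_top[of v] by eventually_elim (use v mono in force)
  next
    fix a assume "L < a"
    show "eventually (\<lambda>u. W u < a) at_top"
      using eventually_ge_at_top[of u0]
    proof eventually_elim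
      case (elim u)
      hence "W u \<le> L" unfolding L_def using bd by (intro cSUP_upper) auto
      thus ?case using \<open>L < a\<close> by simp
    qed
  qed
  have "((\<lambda>u::real. u powr q) \<longlongrightarrow> 0) at_top" using q by real_asymp
  hence lims: "((\<lambda>u. C * (u powr q - v powr q)) \<longlongrightarrow> C * (0 - v powr q)) at_top" for C v
    by (intro tendsto_intros)
  have "(c / (2 * -q)) * v powr q \<le> L - W v \<and> L - W v \<le> (2 * c / -q) * v powr q" if "u0 \<le> v" for v
  proof
    have "c / (2 * q) * (0 - v powr q) \<le> L - W v"
      by (rule tendsto_le[OF trivial_limit_at_top_linorder tendsto_diff[OF L tendsto_const] lims])
         (rule eventually_mono[OF eventually_ge_at_top[of v] lo[OF that]], auto)
    thus "(c / (2 * -q)) * v powr q \<le> L - W v" by simp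
    have "L - W v \<le> 2 * c / q * (0 - v powr q)"
      by (rule tendsto_le[OF trivial_limit_at_top_linorder lims tendsto_diff[OF L tendsto_const]])
         (rule eventually_mono[OF eventually_ge_at_top[of v] up[OF that]], auto)
    thus "L - W v \<le> (2 * c / -q) * v powr q" by simp
  qed
  hence "eventually (\<lambda>v. (c / (2 * -q)) * v powr q \<le> L - W v \<and> L - W v \<le> (2 * c / -q) * v powr q) at_top"
    unfolding eventually_at_top_linorder by blast
  moreover have "0 < c / (2 * -q)" using c q by (intro divide_pos_pos) auto
  ultimately show ?thesis using L by blast
qed

section \<open>Orbits in the coordinate u\<close>

text \<open>By the mean value theorem the step is \<open>(\<psi> u - \<phi> u) / - \<psi>' z\<close>
  with z between u and \<open>\<tau> u\<close>: order u^(r+1-k) over order u^r.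
  \<open>\<psi>\<close> is the integral evaluated at the new point and \<open>\<phi>\<close> the one
  at the old point, so exchanging them treats the slow relation and its inverse alike.\<close>

lemma orbit_step_bounds:
  fixes \<psi> \<psi>' \<phi> \<tau> :: "real \<Rightarrow> real"
  assumes k: "1 \<le> k"
    and der: "\<And>u. 0 < u \<Longrightarrow> (\<psi> has_real_derivative \<psi>' u) (at u)"
    and lim: "((\<lambda>u. \<psi>' u / u ^ r) \<longlongrightarrow> - e) at_top" and e: "0 < e"
    and anti: "\<And>u v. 0 \<le> u \<Longrightarrow> u < v \<Longrightarrow> \<psi> v < \<psi> u"
    and \<tau>: "\<And>u. 0 < u \<Longrightarrow> 0 \<le> \<tau> u \<and> \<psi> (\<tau> u) = \<phi> u"
    and d1: "0 < d1"
    and D: "eventually (\<lambda>u. d1 * u ^ Suc r \<le> (\<psi> u - \<phi> u) * u ^ k \<and> (\<psi> u - \<phi> u) * u ^ k \<le> d2 * u ^ Suc r) at_top"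
  shows "\<exists>c1>0. \<exists>c2. eventually (\<lambda>u. c1 \<le> (\<tau> u - u) * u ^ (k - 1) \<and> (\<tau> u - u) * u ^ (k - 1) \<le> c2) at_top"
proof -
  obtain k' where k': "k = Suc k'" using k by (cases k) auto
  have "eventually (\<lambda>u. - (2 * e) < \<psi>' u / u ^ r \<and> \<psi>' u / u ^ r < - (e / 2)) at_top"
    using e by (intro eventually_conj order_tendstoD[OF lim]) auto
  then obtain u1 where u1: "\<And>u. u1 \<le> u \<Longrightarrow> - (2 * e) < \<psi>' u / u ^ r \<and> \<psi>' u / u ^ r < - (e / 2)"
    unfolding eventually_at_top_linorder by blast
  have b: "\<psi>' u \<le> - (e / 2) * u ^ r" "- (2 * e) * u ^ r \<le> \<psi>' u" if "u1 \<le> u" "0 < u" for u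
    using u1[OF that(1)] that(2) by (auto simp: divide_simps split: if_splits)
  define R where "R = 1 + 2 * d2 / e"
  have key: "d1 / (2 * e * R ^ r) \<le> (\<tau> u - u) * u ^ k' \<and> (\<tau> u - u) * u ^ k' \<le> 2 * d2 / e \<and> R > 1"
    if u: "1 \<le> u" "u1 \<le> u" and Du: "d1 * u ^ Suc r \<le> (\<psi> u - \<phi> u) * u ^ k" "(\<psi> u - \<phi> u) * u ^ k \<le> d2 * u ^ Suc r" for u
  proof -
    define v where "v = \<tau> u"
    have u0: "0 < u" using u by simp
    have v: "0 \<le> v" "\<psi> v = \<phi> u" using \<tau>[OF u0] by (auto simp: v_def)
    have "0 < d1 * u ^ Suc r" using d1 u0 by simp
    hence "0 < (\<psi> u - \<phi> u) * u ^ k" using Du(1) by linarith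
    hence pos: "\<phi> u < \<psi> u" using u0 by (simp add: zero_less_mult_iff)
    have "u < v"
    proof (rule ccontr)
      assume "\<not> u < v"
      hence "\<psi> u \<le> \<psi> v" using anti[of v u] v by (cases "u = v") auto
      thus False using pos v by simp
    qed
    then obtain z where z: "u < z" "z < v" "\<psi> v - \<psi> u = (v - u) * \<psi>' z"
      using MVT2[of u v \<psi> \<psi>'] der u0 by (metis less_le_trans)
    have z0: "u1 \<le> z" "0 < z" using z u u0 by auto
    have eq: "\<psi> u - \<phi> u = (v - u) * - \<psi>' z" using z v by simp
    have U: "0 < u ^ Suc r" using u0 by simp
    have "(e / 2) * u ^ r \<le> (e / 2) * z ^ r"
      using z u0 e by (intro mult_left_mono power_mono) auto
    hence "(e / 2) * u ^ r \<le> - \<psi>' z" using b(1)[OF z0] by linarith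
    hence "(v - u) * ((e / 2) * u ^ r) \<le> \<psi> u - \<phi> u"
      unfolding eq using \<open>u < v\<close> by (intro mult_left_mono) auto
    hence "(v - u) * ((e / 2) * u ^ r) * u ^ k \<le> d2 * u ^ Suc r"
      using Du(2) u0 by (smt (verit) mult_right_mono zero_le_power)
    hence "((v - u) * u ^ k' * (e / 2)) * u ^ Suc r \<le> d2 * u ^ Suc r" by (simp add: k' algebra_simps)
    hence "(v - u) * u ^ k' * (e / 2) \<le> d2" using U mult_le_cancel_right_pos by blast
    hence up: "(v - u) * u ^ k' \<le> 2 * d2 / e" using e by (simp add: field_simps)
    have lo0: "v - u \<le> (v - u) * u ^ k'"
      using mult_left_mono[OF one_le_power[OF u(1), of k'], of "v - u"] \<open>u < v\<close> by simp
    hence "0 < 2 * d2 / e" using up \<open>u < v\<close> by linarith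
    hence R1: "R > 1" by (simp add: R_def)
    \<comment> \<open>The upper bound on the step is fed back here: it confines z below
      \<open>R * u\<close>, which bounds the slope at z from the other side and yields the lower
      bound on the step.\<close>
    have "v \<le> u + (R - 1) * 1" using lo0 up by (simp add: R_def)
    also have "\<dots> \<le> u + (R - 1) * u" using R1 u by (intro add_left_mono mult_left_mono) auto
    finally have "v \<le> R * u" by (simp add: algebra_simps)
    hence "z ^ r \<le> (R * u) ^ r" using z z0 by (intro power_mono) auto
    hence "(2 * e) * z ^ r \<le> (2 * e) * (R * u) ^ r" using e by (intro mult_left_mono) auto
    hence "- \<psi>' z \<le> (2 * e) * (R * u) ^ r" using b(2)[OF z0] by linarith
    hence "\<psi> u - \<phi> u \<le> (v - u) * ((2 * e) * (R * u) ^ r)"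
      unfolding eq using \<open>u < v\<close> by (intro mult_left_mono) auto
    hence "d1 * u ^ Suc r \<le> (v - u) * ((2 * e) * (R * u) ^ r) * u ^ k"
      using Du(1) u0 by (smt (verit) mult_right_mono zero_le_power)
    hence "d1 * u ^ Suc r \<le> ((v - u) * u ^ k' * (2 * e * R ^ r)) * u ^ Suc r"
      by (simp add: k' algebra_simps power_mult_distrib)
    hence "d1 \<le> (v - u) * u ^ k' * (2 * e * R ^ r)" using U mult_le_cancel_right_pos by blast
    moreover have "0 < 2 * e * R ^ r" using e R1 by simp
    ultimately have "d1 / (2 * e * R ^ r) \<le> (v - u) * u ^ k'" by (simp add: pos_divide_le_eq)
    thus ?thesis using up R1 by (simp add: v_def)
  qed
  have ev: "eventually (\<lambda>u. d1 / (2 * e * R ^ r) \<le> (\<tau> u - u) * u ^ k' \<and> (\<tau> u - u) * u ^ k' \<le> 2 * d2 / e \<and> R > 1) at_top"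
    using D eventually_ge_at_top[of 1] eventually_ge_at_top[of u1]
    by eventually_elim (use key in blast)
  \<comment> \<open>Positivity of \<open>d2\<close>, and with it \<open>R > 1\<close>, only follows
    from the bounds at some large u; hence it is carried inside the eventual statement and extracted
    here.\<close>
  hence "\<exists>u. R > 1" using eventually_happens[OF ev] by auto
  hence "0 < d1 / (2 * e * R ^ r)" using d1 e by simp
  moreover have "eventually (\<lambda>u. d1 / (2 * e * R ^ r) \<le> (\<tau> u - u) * u ^ (k - 1) \<and> (\<tau> u - u) * u ^ (k - 1) \<le> 2 * d2 / e) at_top"
    using ev by eventually_elim (simp add: k')
  ultimately show ?thesis by blast
qed

text \<open>Passing to u = y^(1/(n+1)) turns the compactified orbit into the reciprocals 1/u. Steps
  beyond the threshold are positive, so an orbit that starts there stays there and the step bounds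
  hold along all of it.\<close>

lemma large_orbits_mono_of_step_bounds:
  fixes T :: "real \<Rightarrow> real"
  assumes k: "1 \<le> k" and c1: "0 < c1" 
    and step: "eventually (\<lambda>u. c1 \<le> (root (n + 1) (T (u ^ (n + 1))) - u) * u ^ (k - 1) \<and>
                 (root (n + 1) (T (u ^ (n + 1))) - u) * u ^ (k - 1) \<le> c2) at_top"
  shows "large_orbits_mono n T (real k / (real k + 1))"
proof -
  obtain w where w: "\<And>u. w \<le> u \<Longrightarrow> c1 \<le> (root (n + 1) (T (u ^ (n + 1))) - u) * u ^ (k - 1) \<and>
                 (root (n + 1) (T (u ^ (n + 1))) - u) * u ^ (k - 1) \<le> c2"
    using step unfolding eventually_at_top_linorder by blast
  define M where "M = (max 1 w) ^ (n + 1)"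
  have "incseq (orbit T y0) \<and> orbit_dim_at_infinity n T y0 (real k / (real k + 1))" if y0: "M < y0" for y0
  proof -
    define y where "y = orbit T y0"
    define u where "u l = root (n + 1) (y l)" for l
    have ySuc: "y (Suc l) = T (y l)" for l by (simp add: y_def orbit_def)
    have u_pow: "u l ^ (n + 1) = y l" if "0 \<le> y l" for l
      unfolding u_def using that by (intro real_root_pow_pos2) auto
    have inv: "max 1 w \<le> u l \<and> 0 < y l" for l
    proof (induction l)
      case 0
      have "y 0 = y0" by (simp add: y_def orbit_def)
      moreover have "max 1 w = root (n + 1) M" unfolding M_def by (simp add: real_root_power_cancel del: power_Suc)
      moreover have "root (n + 1) M \<le> root (n + 1) y0" using y0 by simp
      moreover have "0 < M" by (simp add: M_def)
      ultimately show ?case using y0 by (simp add: u_def)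
    next
      case (Suc l)
      hence "c1 \<le> (u (Suc l) - u l) * u l ^ (k - 1)"
        using w[of "u l"] u_pow[of l] by (simp add: u_def[of "Suc l"] ySuc)
      hence "0 < (u (Suc l) - u l) * u l ^ (k - 1)" using c1 by linarith
      hence "u l < u (Suc l)" using Suc by (simp add: zero_less_mult_iff)
      hence u: "max 1 w \<le> u (Suc l)" using Suc by simp
      hence "0 < root (n + 1) (y (Suc l))" by (simp add: u_def)
      thus ?case using u by simp
    qed
    have y_pow: "y l = u l ^ (n + 1)" for l using u_pow[of l] inv[of l] by simp
    have u1: "1 \<le> u l" for l using inv[of l] by simp
    have step_lo: "c1 \<le> (u (Suc l) - u l) * u l ^ (k - 1)"
      and step_up: "(u (Suc l) - u l) * u l ^ (k - 1) \<le> c2" for l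
      using w[of "u l"] inv[of l] by (simp_all add: u_def[of "Suc l"] ySuc y_pow[of l])
    note R = Minkowski_reciprocals[of k c1 u c2, OF k c1 u1 step_lo step_up]
    have mono: "u l \<le> u (Suc l)" for l
    proof -
      have "0 < (u (Suc l) - u l) * u l ^ (k - 1)" using step_lo[of l] c1 by linarith
      thus ?thesis using u1[of l] by (simp add: zero_less_mult_iff)
    qed
    have inc: "incseq y"
      using mono u1 by (intro incseq_SucI) (metis y_pow power_mono order_trans zero_le_one)
    have top: "filterlim y at_top sequentially"
      unfolding y_pow[abs_def] by (intro filterlim_pow_at_top R(1)) auto
    have "y l powr (- 1 / real (n + 1)) = 1 / u l" for l
    proof -
      have "u l = y l powr (1 / real (n + 1))" 
        unfolding u_def using inv[of l] by (intro root_powr_inverse) auto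
      thus ?thesis by (simp add: powr_minus_divide)
    qed
    hence "compactified n (range y) = range (\<lambda>l. 1 / u l)"
      by (simp add: compactified_def image_image del: of_nat_add)
    thus ?thesis using inc top R by (simp add: orbit_dim_at_infinity_def y_def)
  qed
  moreover have "0 < M" by (simp add: M_def)
  ultimately show ?thesis unfolding large_orbits_mono_def by blast
qed

lemma large_orbits_mono_imp_large_orbits: "large_orbits_mono n T d \<Longrightarrow> large_orbits n T d"
  unfolding large_orbits_mono_def large_orbits_def by blast

section \<open>Polynomial limits, reflection, mean values and change of variable\<close>

lemma filterlim_power_at_top: "0 < k \<Longrightarrow> filterlim (\<lambda>x::real. x ^ k) at_top at_top"
  by (intro filterlim_pow_at_top filterlim_ident)

text \<open>Here d is only a bound for the degree, so the limit may be 0. The filter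
  \<open>at_infinity\<close> covers both ends of the line.\<close>

lemma tendsto_poly_div_power:
  fixes p :: "real poly"
  assumes "\<And>i. d < i \<Longrightarrow> coeff p i = 0"
  shows "((\<lambda>x. poly p x / x ^ d) \<longlongrightarrow> coeff p d) at_infinity"
proof -
  have "poly p x = (\<Sum>i\<le>d. coeff p i * x ^ i)" for x
    unfolding poly_altdef
    by (rule sum.mono_neutral_left) (use degree_le[of d p] assms in \<open>auto simp: coeff_eq_0\<close>)
  hence "poly p x / x ^ d = (\<Sum>i\<le>d. coeff p i * inverse x ^ (d - i))" if "x \<noteq> 0" for x
    using that by (auto simp: sum_divide_distrib power_diff field_simps intro!: sum.cong)
  hence ev: "eventually (\<lambda>x. (\<Sum>i\<le>d. coeff p i * inverse x ^ (d - i)) = poly p x / x ^ d) at_infinity"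
    unfolding eventually_at_infinity by (intro exI[of _ 1]) auto
  have "((\<lambda>x. \<Sum>i\<le>d. coeff p i * inverse x ^ (d - i)) \<longlongrightarrow> (\<Sum>i\<le>d. coeff p i * 0 ^ (d - i))) at_infinity"
    by (intro tendsto_intros tendsto_inverse_0)
  also have "(\<Sum>i\<le>d. coeff p i * 0 ^ (d - i)) = (\<Sum>i\<in>{d}. coeff p i)"
    by (rule sum.mono_neutral_cong_right) auto
  finally show ?thesis using ev by (simp add: tendsto_cong)
qed

definition reflect :: "real poly \<Rightarrow> real poly" where
  "reflect p = pcompose p [:0, -1:]"

lemma poly_reflect [simp]: "poly (reflect p) x = poly p (- x)"
  by (simp add: reflect_def poly_pcompose)

lemma coeff_reflect: "coeff (reflect p) i = (- 1) ^ i * coeff p i"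
  by (simp add: reflect_def coeff_pcompose_linear)

lemma pderiv_reflect: "pderiv (reflect p) = - reflect (pderiv p)"
  by (simp add: reflect_def pderiv_pcompose pderiv_pCons)

text \<open>Made for the comparison of \<open>omega\<close> with \<open>- alpha\<close>, whose order
  depends on the signs of coefficients.\<close>

lemma mvt_unordered:
  fixes f f' :: "real \<Rightarrow> real"
  assumes "\<And>x. min a b \<le> x \<Longrightarrow> (f has_real_derivative f' x) (at x)"
  shows "\<exists>\<xi>. min a b \<le> \<xi> \<and> \<xi> \<le> max a b \<and> f a - f b = (a - b) * f' \<xi>"
proof (cases a b rule: linorder_cases)
  case less
  then obtain z where "a < z" "z < b" "f b - f a = (b - a) * f' z"
    using MVT2[of a b f f'] assms by auto
  thus ?thesis using less by (intro exI[of _ z]) (auto simp: algebra_simps)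
next
  case greater
  then obtain z where "b < z" "z < a" "f a - f b = (a - b) * f' z"
    using MVT2[of b a f f'] assms by auto
  thus ?thesis using greater by (intro exI[of _ z]) auto
qed auto

lemma filterlim_at_top_of_power:
  fixes f :: "real \<Rightarrow> 'a"
  assumes "filterlim (\<lambda>u. f (u ^ Suc n)) F at_top"
  shows "filterlim f F at_top"
proof -
  have "filterlim (root (Suc n)) at_top at_top"
    unfolding filterlim_at_top
  proof
    fix Z :: real
    show "eventually (\<lambda>y. Z \<le> root (Suc n) y) at_top"
      using eventually_ge_at_top[of "\<bar>Z\<bar> ^ Suc n"]
    proof eventually_elim
      case (elim y)
      hence "root (Suc n) (\<bar>Z\<bar> ^ Suc n) \<le> root (Suc n) y" by simp
      thus ?case by (simp add: real_root_power_cancel del: power_Suc)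
    qed
  qed
  hence "filterlim (\<lambda>y. f (root (Suc n) y ^ Suc n)) F at_top"
    by (rule filterlim_compose[OF assms])
  moreover have "eventually (\<lambda>y. f (root (Suc n) y ^ Suc n) = f y) at_top"
    using eventually_ge_at_top[of 0] by eventually_elim (simp del: power_Suc)
  ultimately show ?thesis by (simp only: filterlim_cong)
qed

section \<open>One side of the critical curve\<close>

text \<open>\<open>P\<close> and \<open>Q\<close> are the exact quotients F'(x)/x and G(x)/x.
  Oddness of n and m is included so that the reflected system, with G replaced by -G(-x), keeps the
  leading coefficients 1 and -1 and is again an instance.\<close>

locale lienard_side =
  fixes F G P Q :: "real poly" and n m :: nat
  assumes pderiv_F: "pderiv F = [:0, 1:] * P" and G_eq: "G = [:0, 1:] * Q"
    and F_0: "poly F 0 = 0"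
    and P_pos: "\<And>x. 0 < poly P x" and Q_neg: "\<And>x. poly Q x < 0"
    and coeff_F: "\<And>i. n + 1 < i \<Longrightarrow> coeff F i = 0" and lead_F: "coeff F (n + 1) = 1"
    and coeff_G: "\<And>i. m < i \<Longrightarrow> coeff G i = 0" and lead_G: "coeff G m = - 1"
    and odd_n: "odd n" and odd_m: "odd m" and m_less: "m < 2 * n + 1"
begin

text \<open>Reflecting \<open>x \<mapsto> -x\<close> exchanges \<open>\<omega>\<close> with \<open>-\<alpha>\<close> and \<open>I\<^sub>-\<close> with \<open>I\<^sub>+\<close>, so it suffices to study
  \<open>\<omega>\<close> and \<open>I\<^sub>-\<close>.\<close>

lemma reflected: "lienard_side (reflect F) (- reflect G) (reflect P) (reflect Q) n m"
proof
  show "pderiv (reflect F) = [:0, 1:] * reflect P"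
    by (rule poly_eqI) (simp add: pderiv_reflect coeff_reflect pderiv_F coeff_pCons split: nat.split)
  show "- reflect G = [:0, 1:] * reflect Q"
    by (rule poly_eqI) (simp add: coeff_reflect G_eq coeff_pCons split: nat.split)
qed (use F_0 P_pos Q_neg coeff_F lead_F coeff_G lead_G odd_n odd_m m_less in
  \<open>auto simp: coeff_reflect\<close>)

text \<open>This is F'/G with the common factor x cancelled, hence defined and negative at 0 as
  well.\<close>

definition h :: "real \<Rightarrow> real" where "h x = poly P x / poly Q x"

lemma h_neg: "h x < 0"
  unfolding h_def using P_pos Q_neg by (intro divide_pos_neg) auto

lemma poly_pderiv_F: "poly (pderiv F) x = x * poly P x"
  by (simp add: pderiv_F)

lemma pderiv_F_pos: "0 < x \<Longrightarrow> 0 < poly (pderiv F) x"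
  using P_pos by (simp add: poly_pderiv_F)

lemma h_eq: "x \<noteq> 0 \<Longrightarrow> h x = poly (pderiv F) x / poly G x"
  by (simp add: h_def poly_pderiv_F G_eq)

lemma F_strict_mono: "0 \<le> x \<Longrightarrow> x < y \<Longrightarrow> poly F x < poly F y"
  by (rule DERIV_pos_imp_increasing_open)
     (auto intro!: exI[of _ "poly (pderiv F) _"] pderiv_F_pos poly_DERIV continuous_intros)

lemma F_less_iff: "0 \<le> x \<Longrightarrow> 0 \<le> y \<Longrightarrow> poly F x < poly F y \<longleftrightarrow> x < y"
  using F_strict_mono by (metis less_asym linorder_neqE_linordered_idom)

lemma F_eq_iff: "0 \<le> x \<Longrightarrow> 0 \<le> y \<Longrightarrow> poly F x = poly F y \<longleftrightarrow> x = y"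
  using F_strict_mono by (metis less_irrefl linorder_neqE_linordered_idom)

lemma F_asymp: "((\<lambda>x. poly F x / x ^ (n + 1)) \<longlongrightarrow> 1) at_infinity"
  using tendsto_poly_div_power[of "n + 1" F] coeff_F lead_F by simp

lemma F_at_top: "filterlim (poly F) at_top at_top"
proof -
  have "filterlim (\<lambda>x. poly F x / x ^ (n + 1) * x ^ (n + 1)) at_top at_top"
    by (rule filterlim_tendsto_pos_mult_at_top[OF tendsto_mono[OF at_top_le_at_infinity F_asymp]])
       (auto intro!: filterlim_power_at_top simp del: power_Suc)
  moreover have "eventually (\<lambda>x. poly F x / x ^ (n + 1) * x ^ (n + 1) = poly F x) at_top"
    using eventually_gt_at_top[of 0] by eventually_elim simp
  ultimately show ?thesis by (simp add: filterlim_cong)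
qed

lemma F_surj:
  assumes "0 \<le> y"
  obtains x where "0 \<le> x" "poly F x = y"
proof -
  have "eventually (\<lambda>x. 0 \<le> x \<and> y \<le> poly F x) at_top"
    using F_at_top eventually_ge_at_top[of 0] unfolding filterlim_at_top by (intro eventually_conj) auto
  then obtain z where "0 \<le> z" "y \<le> poly F z"
    by (metis (mono_tags, lifting) eventually_happens trivial_limit_at_top_linorder)
  moreover have "continuous_on {0..z} (poly F)" by (intro continuous_intros)
  ultimately show thesis using IVT'[of "poly F" 0 y z] assms F_0 that by auto
qed

lemma omega_F: "0 \<le> x \<Longrightarrow> omega F (poly F x) = x"
proof -
  assume x: "0 \<le> x"
  show ?thesis
  proof (cases "x = 0")
    case False
    with x have "poly F x \<noteq> 0" using F_eq_iff[of x 0] F_0 by simp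
    moreover have "(THE z. z > 0 \<and> poly F z = poly F x) = x"
      using False x F_eq_iff[of _ x] by (intro the_equality) (auto simp: less_imp_le)
    ultimately show ?thesis by (simp add: omega_def)
  qed (simp add: omega_def F_0)
qed

lemma F_omega: "0 \<le> y \<Longrightarrow> poly F (omega F y) = y"
  and omega_nonneg: "0 \<le> y \<Longrightarrow> 0 \<le> omega F y"
  by (metis F_surj omega_F)+

lemma omega_strict_mono: "0 \<le> y \<Longrightarrow> y < z \<Longrightarrow> omega F y < omega F z"
  using F_less_iff[of "omega F y" "omega F z"] F_omega omega_nonneg by simp

lemma omega_pos: "0 < y \<Longrightarrow> 0 < omega F y"
  using omega_strict_mono[of 0 y] by (simp add: omega_def)

lemma DERIV_omega:
  assumes "0 < y"
  shows "(omega F has_real_derivative inverse (poly (pderiv F) (omega F y))) (at y)"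
proof (rule DERIV_inverse_function[where f = "poly F" and a = 0 and b = "y + 1"])
  show "(poly F has_real_derivative poly (pderiv F) (omega F y)) (at (omega F y))"
    by (rule poly_DERIV)
  show "poly (pderiv F) (omega F y) \<noteq> 0"
    using pderiv_F_pos[OF omega_pos[OF assms]] by simp
  have "isCont (omega F) (poly F (omega F y))"
    by (rule isCont_inverse_function[where d = "omega F y"])
       (use omega_pos[OF assms] in \<open>auto intro!: omega_F continuous_intros\<close>)
  thus "isCont (omega F) y" using F_omega assms by simp
qed (use assms F_omega in auto)

definition J :: "real \<Rightarrow> real" where
  "J x = (LBINT t=ereal 0..ereal x. (poly (pderiv F) t)\<^sup>2 / poly G t)"

text \<open>At t = 0 both sides are 0, the left one because division by 0 yields 0. So the integrand
  is continuous as it stands and the fundamental theorem applies across 0.\<close>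

lemma integrand_eq: "(poly (pderiv F) t)\<^sup>2 / poly G t = poly (pderiv F) t * h t"
  by (cases "t = 0") (simp_all add: poly_pderiv_F h_eq power2_eq_square)

lemma DERIV_J: "(J has_real_derivative poly (pderiv F) x * h x) (at x)"
proof -
  define c where "c = \<bar>x\<bar> + 1"
  have "continuous_on {- c..c} (\<lambda>t. poly (pderiv F) t * h t)"
    unfolding h_def using Q_neg by (intro continuous_intros) (metis less_irrefl)
  hence "((\<lambda>x. LBINT t=ereal 0..ereal x. poly (pderiv F) t * h t) has_vector_derivative 
      poly (pderiv F) x * h x) (at x within {- c..c})"
    by (intro interval_integral_FTC2) (auto simp: c_def)
  moreover have "at x within {- c..c} = at x"
    by (rule at_within_interior) (auto simp: c_def)
  ultimately show ?thesis
    by (simp add: J_def[abs_def] integrand_eq has_real_derivative_iff_has_vector_derivative)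
qed

lemma I_minus_eq: "I_minus F G y = J (omega F y)"
  unfolding I_minus_def J_def zero_ereal_def
  by (subst interval_integral_endpoints_reverse) simp

lemma J_0 [simp]: "J 0 = 0"
  by (simp add: J_def)

lemma J_strict_antimono: "0 \<le> x \<Longrightarrow> x < y \<Longrightarrow> J y < J x"
  by (rule DERIV_neg_imp_decreasing_open)
     (auto intro!: exI[of _ "poly (pderiv F) _ * h _"] mult_pos_neg pderiv_F_pos h_neg DERIV_J
        continuous_at_imp_continuous_on DERIV_isCont)

lemma I_minus_strict_antimono: "0 \<le> y \<Longrightarrow> y < z \<Longrightarrow> I_minus F G z < I_minus F G y"
  unfolding I_minus_eq by (intro J_strict_antimono omega_nonneg omega_strict_mono)

lemma I_minus_nonpos: "0 \<le> y \<Longrightarrow> I_minus F G y \<le> 0"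
  using I_minus_strict_antimono[of 0 y] I_minus_eq[of 0] by (cases "y = 0") (auto simp: omega_def)

section \<open>The right branch and its integral in the coordinate u\<close>

definition om :: "real \<Rightarrow> real" where "om u = omega F (u ^ (n + 1))"

lemma om_nonneg: "0 \<le> u \<Longrightarrow> 0 \<le> om u"
  by (simp add: om_def omega_nonneg)

lemma om_pos: "0 < u \<Longrightarrow> 0 < om u"
  by (simp add: om_def omega_pos)

lemma F_om: "0 \<le> u \<Longrightarrow> poly F (om u) = u ^ (n + 1)"
  by (simp add: om_def F_omega)

lemma om_at_top: "filterlim om at_top at_top"
  unfolding filterlim_at_top_gt[where c = 0]
proof (intro allI impI)
  fix Z :: real assume Z: "0 < Z"
  have "filterlim (\<lambda>u::real. u ^ (n + 1)) at_top at_top"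
    by (rule filterlim_power_at_top) simp
  hence "eventually (\<lambda>u. poly F Z < u ^ (n + 1)) at_top"
    unfolding filterlim_at_top_dense by blast
  thus "eventually (\<lambda>u. Z \<le> om u) at_top"
    using eventually_ge_at_top[of 0]
  proof eventually_elim
    case (elim u)
    have "poly F Z < poly F (om u)" using F_om elim by simp
    thus ?case using F_less_iff[of Z "om u"] Z om_nonneg elim by simp
  qed
qed

text \<open>Since F(x) is asymptotic to x^(n+1) and F(om u) = u^(n+1), the power (u / om u)^(n+1)
  tends to 1; then the root is taken.\<close>

lemma om_ratio: "((\<lambda>u. om u / u) \<longlongrightarrow> 1) at_top"
proof -
  have "((\<lambda>u. poly F (om u) / om u ^ (n + 1)) \<longlongrightarrow> 1) at_top"
    by (rule filterlim_compose[OF tendsto_mono[OF at_top_le_at_infinity F_asymp] om_at_top])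
  hence "((\<lambda>u. inverse (root (n + 1) (poly F (om u) / om u ^ (n + 1)))) \<longlongrightarrow> inverse (root (n + 1) 1)) at_top"
    by (intro tendsto_intros) auto
  hence "((\<lambda>u. inverse (root (n + 1) (poly F (om u) / om u ^ (n + 1)))) \<longlongrightarrow> 1) at_top" by simp
  moreover have "eventually (\<lambda>u. inverse (root (n + 1) (poly F (om u) / om u ^ (n + 1))) = om u / u) at_top"
    using eventually_gt_at_top[of 0]
  proof eventually_elim
    case (elim u)
    have "poly F (om u) / om u ^ (n + 1) = (u / om u) ^ (n + 1)"
      using F_om[of u] elim by (simp add: power_divide)
    moreover have "0 < u / om u" using elim om_pos by simp
    ultimately show ?case by (simp add: real_root_power_cancel del: power_Suc)
  qed
  ultimately show ?thesis by (simp add: tendsto_cong)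
qed

lemma tendsto_along_om:
  assumes "((\<lambda>x. f x) \<longlongrightarrow> c) at_infinity"
  shows "((\<lambda>u. f (om u)) \<longlongrightarrow> c) at_top"
  by (rule filterlim_compose[OF tendsto_mono[OF at_top_le_at_infinity assms] om_at_top])

lemma pderiv_F_asymp: "((\<lambda>x. poly (pderiv F) x / x ^ n) \<longlongrightarrow> real n + 1) at_infinity"
  using tendsto_poly_div_power[of n "pderiv F"] coeff_F lead_F by (simp add: coeff_pderiv add.commute)

lemma G_asymp: "((\<lambda>x. poly G x / x ^ m) \<longlongrightarrow> - 1) at_infinity"
  using tendsto_poly_div_power[of m G] coeff_G lead_G by simp

lemma eventually_nonzero_at_infinity: "eventually (\<lambda>x::real. x \<noteq> 0) at_infinity"
  unfolding eventually_at_infinity by (intro exI[of _ 1]) auto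

text \<open>h behaves like -(n+1) x^(n-m). The exponent can be negative, whence two natural
  powers.\<close>

lemma h_asymp: "((\<lambda>x. h x * x ^ m / x ^ n) \<longlongrightarrow> - (real n + 1)) at_infinity"
proof -
  have "((\<lambda>x. (poly (pderiv F) x / x ^ n) / (poly G x / x ^ m)) \<longlongrightarrow> (real n + 1) / (- 1)) at_infinity"
    by (intro tendsto_divide pderiv_F_asymp G_asymp) auto
  moreover have "eventually (\<lambda>x. (poly (pderiv F) x / x ^ n) / (poly G x / x ^ m) = h x * x ^ m / x ^ n) at_infinity"
    using eventually_nonzero_at_infinity by eventually_elim (simp add: h_eq field_simps)
  ultimately show ?thesis by (simp add: tendsto_cong)
qed

definition \<psi> :: "real \<Rightarrow> real" where "\<psi> u = I_minus F G (u ^ (n + 1))"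

lemma \<psi>_eq: "\<psi> u = J (om u)"
  by (simp add: \<psi>_def om_def I_minus_eq)

text \<open>The factor F'(om u) from the integrand cancels the inverse factor from the derivative of
  \<open>omega\<close>, so only h is left.\<close>

lemma DERIV_\<psi>:
  assumes "0 < u"
  shows "(\<psi> has_real_derivative (real n + 1) * u ^ n * h (om u)) (at u)"
proof -
  have "((\<lambda>u. u ^ (n + 1)) has_real_derivative real (n + 1) * u ^ n) (at u)"
    using DERIV_pow[of "n + 1" u] by simp
  hence "((\<lambda>u. J (om u)) has_real_derivative
      poly (pderiv F) (om u) * h (om u) * (inverse (poly (pderiv F) (om u)) * (real (n + 1) * u ^ n))) (at u)"
    unfolding om_def using assms by (intro DERIV_chain2[OF DERIV_J] DERIV_chain2[OF DERIV_omega]) auto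
  also have "poly (pderiv F) (om u) * h (om u) * (inverse (poly (pderiv F) (om u)) * (real (n + 1) * u ^ n)) =
      (real n + 1) * u ^ n * h (om u)"
    using pderiv_F_pos[OF om_pos[OF assms]] by (simp add: field_simps)
  finally show ?thesis by (simp only: \<psi>_eq[abs_def])
qed

lemma \<psi>_asymp: "((\<lambda>u. (real n + 1) * u ^ n * h (om u) / u ^ (2 * n - m)) \<longlongrightarrow> - ((real n + 1)\<^sup>2)) at_top"
proof -
  have "((\<lambda>u. (real n + 1) * (h (om u) * om u ^ m / om u ^ n) * (om u / u) ^ n / (om u / u) ^ m)
      \<longlongrightarrow> (real n + 1) * (- (real n + 1)) * 1 ^ n / 1 ^ m) at_top"
    by (intro tendsto_intros om_ratio tendsto_along_om[OF h_asymp]) auto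
  moreover have "eventually (\<lambda>u. (real n + 1) * (h (om u) * om u ^ m / om u ^ n) * (om u / u) ^ n / (om u / u) ^ m =
     (real n + 1) * u ^ n * h (om u) / u ^ (2 * n - m)) at_top"
    using eventually_gt_at_top[of 0]
  proof eventually_elim
    case (elim u)
    define w where "w = om u"
    have w: "0 < w" using om_pos elim by (simp add: w_def)
    have "u ^ n * u ^ n = u ^ (2 * n - m) * u ^ m"
      using m_less by (simp flip: power_add mult_2)
    hence "u ^ m / u ^ n = u ^ n / u ^ (2 * n - m)"
      using elim by (simp add: frac_eq_eq mult.commute)
    moreover have "(real n + 1) * (h w * w ^ m / w ^ n) * (w / u) ^ n / (w / u) ^ m = (real n + 1) * h w * (u ^ m / u ^ n)"
      using w elim by (simp add: power_divide)
    ultimately show ?case by (simp add: w_def[symmetric])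
  qed
  ultimately show ?thesis by (simp add: tendsto_cong power2_eq_square algebra_simps)
qed

text \<open>The assumption m < 2n+1 makes p positive, so a derivative of order u^(p-1) integrates to
  an unbounded function.\<close>

lemma \<psi>_at_bot: "filterlim \<psi> at_bot at_top"
proof -
  define p where "p = real (2 * n + 1 - m)"
  have p: "0 < p" "1 - p = - real (2 * n - m)" using m_less by (auto simp: p_def of_nat_diff)
  have "((\<lambda>u. - ((real n + 1) * u ^ n * h (om u)) * u powr (1 - p)) \<longlongrightarrow> (real n + 1)\<^sup>2) at_top"
  proof -
    have "((\<lambda>u. - ((real n + 1) * u ^ n * h (om u) / u ^ (2 * n - m))) \<longlongrightarrow> - (- ((real n + 1)\<^sup>2))) at_top"
      by (rule tendsto_minus[OF \<psi>_asymp])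
    moreover have "eventually (\<lambda>u. - ((real n + 1) * u ^ n * h (om u) / u ^ (2 * n - m)) =
       - ((real n + 1) * u ^ n * h (om u)) * u powr (1 - p)) at_top"
      using eventually_gt_at_top[of 0]
      by eventually_elim (simp only: p(2), simp add: powr_minus powr_realpow divide_inverse)
    ultimately show ?thesis using Lim_transform_eventually by fastforce
  qed
  from antiderivative_growth[OF DERIV_minus[OF DERIV_\<psi>] this _ p(1)]
  obtain c1 c2 where c1: "0 < c1"
    and "eventually (\<lambda>u. c1 * u powr p \<le> - \<psi> u \<and> - \<psi> u \<le> c2 * u powr p) at_top" by auto
  hence ev: "eventually (\<lambda>u. c1 * u powr p \<le> - \<psi> u) at_top" by (auto elim: eventually_mono)
  have "filterlim (\<lambda>u. c1 * u powr p) at_top at_top" using c1 p(1) by real_asymp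
  hence "filterlim (\<lambda>u. - \<psi> u) at_top at_top" by (rule filterlim_at_top_mono[OF _ ev])
  thus ?thesis by (simp add: filterlim_uminus_at_bot)
qed

text \<open>Intermediate values of \<open>J\<close> between 0 and a point where
  \<open>\<psi>\<close> has fallen below v. This is what makes the slow relation total and
  onto.\<close>

lemma I_minus_surj:
  assumes "v \<le> 0"
  obtains y where "0 \<le> y" "I_minus F G y = v"
proof -
  have "eventually (\<lambda>u. \<psi> u \<le> v \<and> 0 \<le> u) at_top"
    using \<psi>_at_bot eventually_ge_at_top[of 0] unfolding filterlim_at_bot by (intro eventually_conj) auto
  then obtain u where u: "\<psi> u \<le> v" "0 \<le> u"
    by (metis (mono_tags, lifting) eventually_happens trivial_limit_at_top_linorder)
  have "0 \<le> om u" using om_nonneg u by simp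
  moreover have "continuous_on {0..om u} J"
    by (intro continuous_at_imp_continuous_on ballI DERIV_isCont[OF DERIV_J])
  ultimately obtain x where "0 \<le> x" "J x = v"
    using IVT2'[of J "om u" v 0] u assms by (auto simp: \<psi>_eq)
  moreover from this have "0 \<le> poly F x" using F_strict_mono[of 0 x] F_0 by (cases "x = 0") auto
  ultimately show thesis using that[of "poly F x"] by (simp add: I_minus_eq omega_F)
qed

lemma alpha_eq: "0 \<le> y \<Longrightarrow> alpha F y = - omega (reflect F) y"
proof (cases "y = 0")
  case False
  assume "0 \<le> y"
  interpret R: lienard_side "reflect F" "- reflect G" "reflect P" "reflect Q" n m by (rule reflected)
  have "(THE x. x < 0 \<and> poly F x = y) = - omega (reflect F) y"
  proof (rule the_equality)
    show "- omega (reflect F) y < 0 \<and> poly F (- omega (reflect F) y) = y"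
      using R.omega_pos[of y] R.F_omega[of y] False \<open>0 \<le> y\<close> by simp
  next
    fix x assume "x < 0 \<and> poly F x = y"
    thus "x = - omega (reflect F) y" using R.omega_F[of "- x"] by auto
  qed
  thus ?thesis using False by (simp add: alpha_def)
qed (simp add: alpha_def omega_def)

text \<open>The orientation sign produced by x -> -x is absorbed into G, which is why the reflected
  system carries \<open>- reflect G\<close>.\<close>

lemma I_plus_eq: "0 \<le> y \<Longrightarrow> I_plus F G y = I_minus (reflect F) (- reflect G) y"
proof -
  assume y: "0 \<le> y"
  define \<beta> where "\<beta> = omega (reflect F) y"
  have "(LBINT x=ereal (- \<beta>)..0. (poly (pderiv F) x)\<^sup>2 / poly G x) =
      (LBINT x=0..ereal \<beta>. (poly (pderiv F) (- x))\<^sup>2 / poly G (- x))"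
    by (subst interval_integral_reflect) simp
  also have "\<dots> = - (LBINT x=ereal \<beta>..0. (poly (pderiv F) (- x))\<^sup>2 / poly G (- x))"
    by (rule interval_integral_endpoints_reverse)
  also have "\<dots> = (LBINT x=ereal \<beta>..0. - ((poly (pderiv F) (- x))\<^sup>2 / poly G (- x)))"
    by (simp add: interval_lebesgue_integral_uminus)
  also have "\<dots> = (LBINT x=ereal \<beta>..0. (poly (pderiv (reflect F)) x)\<^sup>2 / poly (- reflect G) x)"
    by (simp add: pderiv_reflect)
  finally show ?thesis by (simp add: I_plus_def I_minus_def alpha_eq[OF y] \<beta>_def)
qed

section \<open>Asymptotics of the derivative of I\<close>

text \<open>For u > 0 the point \<open>alpha F (u ^ (n + 1))\<close> is
  \<open>- be u\<close>.\<close>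

definition be :: "real \<Rightarrow> real" where "be u = omega (reflect F) (u ^ (n + 1))"

definition h' :: "real \<Rightarrow> real" where
  "h' x = (poly (pderiv (pderiv F)) x * poly G x - poly (pderiv F) x * poly (pderiv G) x) / (poly G x)\<^sup>2"

lemma DERIV_h: "0 < x \<Longrightarrow> (h has_real_derivative h' x) (at x)"
proof -
  assume x: "0 < x"
  have "poly Q x \<noteq> 0" using Q_neg[of x] by simp
  hence "(h has_real_derivative (poly (pderiv P) x * poly Q x - poly P x * poly (pderiv Q) x) / (poly Q x * poly Q x)) (at x)"
    unfolding h_def[abs_def] by (intro DERIV_divide poly_DERIV)
  also have "(poly (pderiv P) x * poly Q x - poly P x * poly (pderiv Q) x) / (poly Q x * poly Q x) = h' x"
  proof -
    have "poly G x = x * poly Q x" "poly (pderiv G) x = poly Q x + x * poly (pderiv Q) x"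
      "poly (pderiv (pderiv F)) x = poly P x + x * poly (pderiv P) x"
      by (simp_all add: G_eq pderiv_F pderiv_mult pderiv_pCons)
    thus ?thesis using x \<open>poly Q x \<noteq> 0\<close>
      by (simp add: h'_def poly_pderiv_F power2_eq_square divide_simps) (simp add: algebra_simps)
  qed
  finally show ?thesis .
qed

text \<open>The limit is what formal differentiation of -(n+1) x^(n-m) predicts; it is proved from
  the quotient rule by dividing each factor by its leading power.\<close>

lemma h'_asymp: "((\<lambda>x. h' x * x * x ^ m / x ^ n) \<longlongrightarrow> (real n + 1) * (real m - real n)) at_infinity"
proof -
  have n: "0 < n" and m: "0 < m" using odd_n odd_m by (auto simp: odd_pos)
  have F'': "((\<lambda>x. poly (pderiv (pderiv F)) x * x / x ^ n) \<longlongrightarrow> real n * (real n + 1)) at_infinity"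
    using tendsto_poly_div_power[of n "[:0, 1:] * pderiv (pderiv F)"] coeff_F lead_F n
    by (cases n) (auto simp: coeff_pderiv coeff_pCons mult.commute add.commute split: nat.splits)
  have G': "((\<lambda>x. poly (pderiv G) x * x / x ^ m) \<longlongrightarrow> - real m) at_infinity"
    using tendsto_poly_div_power[of m "[:0, 1:] * pderiv G"] coeff_G lead_G m
    by (cases m) (auto simp: coeff_pderiv coeff_pCons mult.commute add.commute split: nat.splits)
  have "((\<lambda>x. ((poly (pderiv (pderiv F)) x * x / x ^ n) * (poly G x / x ^ m) -
         (poly (pderiv F) x / x ^ n) * (poly (pderiv G) x * x / x ^ m)) / (poly G x / x ^ m)\<^sup>2) \<longlongrightarrow>
      (real n * (real n + 1) * (- 1) - (real n + 1) * (- real m)) / (- 1)\<^sup>2) at_infinity"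
    by (intro tendsto_intros F'' G' pderiv_F_asymp G_asymp) auto
  moreover have "eventually (\<lambda>x. ((poly (pderiv (pderiv F)) x * x / x ^ n) * (poly G x / x ^ m) -
         (poly (pderiv F) x / x ^ n) * (poly (pderiv G) x * x / x ^ m)) / (poly G x / x ^ m)\<^sup>2 =
      h' x * x * x ^ m / x ^ n) at_infinity"
    using eventually_nonzero_at_infinity
  proof eventually_elim
    case (elim x)
    have "poly G x \<noteq> 0" using elim Q_neg[of x] by (simp add: G_eq)
    thus ?case using elim unfolding h'_def
      by (simp add: power2_eq_square divide_simps) (simp add: algebra_simps)
  qed
  ultimately show ?thesis by (simp add: tendsto_cong algebra_simps)
qed

text \<open>Over the common denominator G(x) G(-x) the numerator is F'(x) (G(x) + G(-x)) - (F'(x) +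
  F'(-x)) G(x), so only the even parts of G and F' produce a difference. The denominator over x^(2m)
  tends to -1.\<close>

lemma h_odd_asymp:
  assumes F': "((\<lambda>x. (poly (pderiv F) x + poly (pderiv F) (- x)) * x ^ k / x ^ n) \<longlongrightarrow> B') at_infinity"
    and G: "((\<lambda>x. (poly G x + poly G (- x)) * x ^ k / x ^ m) \<longlongrightarrow> A') at_infinity"
  shows "((\<lambda>x. (h x - h (- x)) * x ^ k * x ^ m / x ^ n) \<longlongrightarrow> - ((real n + 1) * A' + B')) at_infinity"
proof -
  interpret R: lienard_side "reflect F" "- reflect G" "reflect P" "reflect Q" n m by (rule reflected)
  have "((\<lambda>x. ((poly (pderiv F) x / x ^ n) * ((poly G x + poly G (- x)) * x ^ k / x ^ m) -
        ((poly (pderiv F) x + poly (pderiv F) (- x)) * x ^ k / x ^ n) * (poly G x / x ^ m)) /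
        ((poly G x / x ^ m) * - (poly (- reflect G) x / x ^ m))) \<longlongrightarrow>
      ((real n + 1) * A' - B' * (- 1)) / ((- 1) * - (- 1))) at_infinity"
    by (intro tendsto_intros assms pderiv_F_asymp G_asymp R.G_asymp) auto
  moreover have "eventually (\<lambda>x. ((poly (pderiv F) x / x ^ n) * ((poly G x + poly G (- x)) * x ^ k / x ^ m) -
        ((poly (pderiv F) x + poly (pderiv F) (- x)) * x ^ k / x ^ n) * (poly G x / x ^ m)) /
        ((poly G x / x ^ m) * - (poly (- reflect G) x / x ^ m)) =
      (h x - h (- x)) * x ^ k * x ^ m / x ^ n) at_infinity"
    using eventually_nonzero_at_infinity
  proof eventually_elim
    case (elim x)
    have "poly G x \<noteq> 0" "poly G (- x) \<noteq> 0" using elim Q_neg[of x] Q_neg[of "- x"] by (simp_all add: G_eq)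
    thus ?case using elim h_eq[of x] h_eq[of "- x"]
      by (simp add: divide_simps) (simp add: algebra_simps)
  qed
  ultimately show ?thesis by (simp add: tendsto_cong)
qed

text \<open>With \<open>\<omega> = om u\<close> and \<open>\<beta> = be u\<close>, split \<open>h(\<omega>) - h(-\<beta>) = (h(\<omega>) - h(\<beta>)) + (h(\<beta>) - h(-\<beta>))\<close>. The first
  difference is \<open>h'(\<eta>) (\<omega> - \<beta>)\<close>, and \<open>F(\<omega>) = F(-\<beta>)\<close> gives \<open>F'(\<xi>) (\<omega> - \<beta>) = F(-\<beta>) - F(\<beta>)\<close>.\<close>

lemma h_difference_asymp:
  assumes oF: "((\<lambda>x. (poly F x - poly F (- x)) * x ^ k / x ^ (n + 1)) \<longlongrightarrow> B) at_infinity"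
    and F': "((\<lambda>x. (poly (pderiv F) x + poly (pderiv F) (- x)) * x ^ k / x ^ n) \<longlongrightarrow> B') at_infinity"
    and G: "((\<lambda>x. (poly G x + poly G (- x)) * x ^ k / x ^ m) \<longlongrightarrow> A') at_infinity"
  shows "((\<lambda>u. (h (om u) - h (- be u)) * u ^ k * u ^ m / u ^ n) \<longlongrightarrow>
      - (B * (real m - real n) + (real n + 1) * A' + B')) at_top"
proof -
  interpret R: lienard_side "reflect F" "- reflect G" "reflect P" "reflect Q" n m by (rule reflected)
  have be: "R.om = be" by (simp add: fun_eq_iff R.om_def be_def)
  note be_pos = R.om_pos[unfolded be] and be_ratio = R.om_ratio[unfolded be]
    and be_at_top = R.om_at_top[unfolded be] and along_be = R.tendsto_along_om[unfolded be]
  have om_be: "((\<lambda>u. om u / be u) \<longlongrightarrow> 1) at_top"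
  proof -
    have "((\<lambda>u. (om u / u) / (be u / u)) \<longlongrightarrow> 1) at_top"
      using tendsto_divide[OF om_ratio be_ratio] by simp
    moreover have "eventually (\<lambda>u. (om u / u) / (be u / u) = om u / be u) at_top"
      using eventually_gt_at_top[of 0] by eventually_elim simp
    ultimately show ?thesis by (rule Lim_transform_eventually)
  qed
  \<comment> \<open>The mean value points are chosen separately for each u. All that the limits need
    is that they are squeezed between \<open>om\<close> and \<open>be\<close>, both asymptotic to
    u.\<close>
  have between: "filterlim \<xi> at_top at_top \<and> ((\<lambda>u. \<xi> u / be u) \<longlongrightarrow> 1) at_top"
    if \<xi>: "\<And>u. 0 < u \<Longrightarrow> min (om u) (be u) \<le> \<xi> u \<and> \<xi> u \<le> max (om u) (be u)" for \<xi> :: "real \<Rightarrow> real"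
  proof
    show lim: "((\<lambda>u. \<xi> u / be u) \<longlongrightarrow> 1) at_top"
    proof (rule tendsto_sandwich)
      show "((\<lambda>u. min (om u / be u) 1) \<longlongrightarrow> 1) at_top" using tendsto_min[OF om_be tendsto_const[of 1]] by simp
      show "((\<lambda>u. max (om u / be u) 1) \<longlongrightarrow> 1) at_top" using tendsto_max[OF om_be tendsto_const[of 1]] by simp
      show "eventually (\<lambda>u. min (om u / be u) 1 \<le> \<xi> u / be u) at_top"
        using eventually_gt_at_top[of 0]
        by eventually_elim (use \<xi> be_pos in \<open>fastforce simp: min_def divide_simps split: if_splits\<close>)
      show "eventually (\<lambda>u. \<xi> u / be u \<le> max (om u / be u) 1) at_top"
        using eventually_gt_at_top[of 0]
        by eventually_elim (use \<xi> be_pos in \<open>fastforce simp: max_def divide_simps split: if_splits\<close>)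
    qed
    have "filterlim (\<lambda>u. \<xi> u / be u * be u) at_top at_top"
      by (rule filterlim_tendsto_pos_mult_at_top[OF lim _ be_at_top]) simp
    moreover have "eventually (\<lambda>u. \<xi> u / be u * be u = \<xi> u) at_top"
      using eventually_gt_at_top[of 0] by eventually_elim (use be_pos in force)
    ultimately show "filterlim \<xi> at_top at_top" by (simp add: filterlim_cong)
  qed
  have "\<exists>\<xi>. min (om u) (be u) \<le> \<xi> \<and> \<xi> \<le> max (om u) (be u) \<and>
      poly F (om u) - poly F (be u) = (om u - be u) * poly (pderiv F) \<xi>" for u
    by (rule mvt_unordered) (rule poly_DERIV)
  then obtain \<xi> where \<xi>: "\<And>u. min (om u) (be u) \<le> \<xi> u \<and> \<xi> u \<le> max (om u) (be u)"
    "\<And>u. poly F (om u) - poly F (be u) = (om u - be u) * poly (pderiv F) (\<xi> u)" by metis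
  have "\<exists>\<eta>. 0 < u \<longrightarrow> min (om u) (be u) \<le> \<eta> \<and> \<eta> \<le> max (om u) (be u) \<and>
      h (om u) - h (be u) = (om u - be u) * h' \<eta>" for u
    using mvt_unordered[of "om u" "be u" h h'] DERIV_h om_pos[of u] be_pos[of u] by force
  then obtain \<eta> where \<eta>: "\<And>u. 0 < u \<Longrightarrow> min (om u) (be u) \<le> \<eta> u \<and> \<eta> u \<le> max (om u) (be u)"
    "\<And>u. 0 < u \<Longrightarrow> h (om u) - h (be u) = (om u - be u) * h' (\<eta> u)" by metis
  have \<xi>_lim: "filterlim \<xi> at_top at_top" "((\<lambda>u. \<xi> u / be u) \<longlongrightarrow> 1) at_top"
    using between[of \<xi>] \<xi>(1) by blast+
  have \<eta>_lim: "filterlim \<eta> at_top at_top" "((\<lambda>u. \<eta> u / be u) \<longlongrightarrow> 1) at_top"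
    using between[of \<eta>] \<eta>(1) by blast+
  have posd: "0 < u \<Longrightarrow> 0 < om u \<and> 0 < be u \<and> 0 < \<xi> u \<and> 0 < \<eta> u" for u
    using om_pos[of u] be_pos[of u] \<xi>(1)[of u] \<eta>(1)[of u] by (auto simp: min_def split: if_splits)

  \<comment> \<open>The displacement of \<open>omega\<close> against \<open>- alpha\<close>: the odd
    part of F divided by its slope, of order u^(1-k).\<close>
  have shift: "((\<lambda>u. (om u - be u) * be u ^ k / be u) \<longlongrightarrow> - B / (real n + 1)) at_top"
  proof -
    have "((\<lambda>u. - ((poly F (be u) - poly F (- be u)) * be u ^ k / be u ^ (n + 1)) /
          ((poly (pderiv F) (\<xi> u) / \<xi> u ^ n) * (\<xi> u / be u) ^ n)) \<longlongrightarrow> - B / ((real n + 1) * 1 ^ n)) at_top"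
      by (intro tendsto_intros along_be[OF oF] \<xi>_lim(2)
            filterlim_compose[OF tendsto_mono[OF at_top_le_at_infinity pderiv_F_asymp] \<xi>_lim(1)]) auto
    moreover have "eventually (\<lambda>u. - ((poly F (be u) - poly F (- be u)) * be u ^ k / be u ^ (n + 1)) /
          ((poly (pderiv F) (\<xi> u) / \<xi> u ^ n) * (\<xi> u / be u) ^ n) = (om u - be u) * be u ^ k / be u) at_top"
      using eventually_gt_at_top[of 0]
    proof eventually_elim
      case (elim u)
      note p = posd[OF elim]
      have "poly F (- be u) = poly F (om u)"
        using F_om[of u] R.F_om[of u] elim by (simp add: be)
      hence e: "poly F (be u) - poly F (- be u) = - ((om u - be u) * poly (pderiv F) (\<xi> u))"
        using \<xi>(2)[of u] by simp
      have "poly (pderiv F) (\<xi> u) \<noteq> 0" using pderiv_F_pos[of "\<xi> u"] p by simp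
      thus ?case unfolding e using p by (simp add: power_divide)
    qed
    ultimately show ?thesis by (simp add: tendsto_cong)
  qed
  have first: "((\<lambda>u. (h (om u) - h (be u)) * be u ^ k * be u ^ m / be u ^ n) \<longlongrightarrow> - B * (real m - real n)) at_top"
  proof -
    have "((\<lambda>u. (h' (\<eta> u) * \<eta> u * \<eta> u ^ m / \<eta> u ^ n) * (\<eta> u / be u) ^ n / ((\<eta> u / be u) ^ m * (\<eta> u / be u)) *
        ((om u - be u) * be u ^ k / be u)) \<longlongrightarrow>
        ((real n + 1) * (real m - real n)) * 1 ^ n / (1 ^ m * 1) * (- B / (real n + 1))) at_top"
      by (intro tendsto_intros shift \<eta>_lim(2)
            filterlim_compose[OF tendsto_mono[OF at_top_le_at_infinity h'_asymp] \<eta>_lim(1)]) auto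
    moreover have "eventually (\<lambda>u. (h' (\<eta> u) * \<eta> u * \<eta> u ^ m / \<eta> u ^ n) * (\<eta> u / be u) ^ n /
        ((\<eta> u / be u) ^ m * (\<eta> u / be u)) * ((om u - be u) * be u ^ k / be u) =
        (h (om u) - h (be u)) * be u ^ k * be u ^ m / be u ^ n) at_top"
      using eventually_gt_at_top[of 0]
    proof eventually_elim
      case (elim u)
      show ?case unfolding \<eta>(2)[OF elim] using posd[OF elim] by (simp add: power_divide)
    qed
    ultimately have "((\<lambda>u. (h (om u) - h (be u)) * be u ^ k * be u ^ m / be u ^ n) \<longlongrightarrow>
        ((real n + 1) * (real m - real n)) * 1 ^ n / (1 ^ m * 1) * (- B / (real n + 1))) at_top"
      by (rule Lim_transform_eventually)
    moreover have "((real n + 1) * (real m - real n)) * 1 ^ n / (1 ^ m * 1) * (- B / (real n + 1)) = - B * (real m - real n)"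
      by (simp add: field_simps)
    ultimately show ?thesis by (simp only:)
  qed
  \<comment> \<open>The limits so far are normalized by powers of \<open>be u\<close>; the quotients
    be u / u, which tend to 1, convert them to powers of u.\<close>
  have "((\<lambda>u. ((h (om u) - h (be u)) * be u ^ k * be u ^ m / be u ^ n +
        (h (be u) - h (- be u)) * be u ^ k * be u ^ m / be u ^ n) * (be u / u) ^ n / ((be u / u) ^ k * (be u / u) ^ m)) \<longlongrightarrow>
      (- B * (real m - real n) + - ((real n + 1) * A' + B')) * 1 ^ n / (1 ^ k * 1 ^ m)) at_top"
    by (intro tendsto_intros first along_be[OF h_odd_asymp[OF F' G]] be_ratio) auto
  moreover have "eventually (\<lambda>u. ((h (om u) - h (be u)) * be u ^ k * be u ^ m / be u ^ n +
        (h (be u) - h (- be u)) * be u ^ k * be u ^ m / be u ^ n) * (be u / u) ^ n / ((be u / u) ^ k * (be u / u) ^ m) =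
      (h (om u) - h (- be u)) * u ^ k * u ^ m / u ^ n) at_top"
    using eventually_gt_at_top[of 0]
  proof eventually_elim
    case (elim u)
    have "(h (om u) - h (be u)) * be u ^ k * be u ^ m / be u ^ n +
        (h (be u) - h (- be u)) * be u ^ k * be u ^ m / be u ^ n =
        (h (om u) - h (- be u)) * be u ^ k * be u ^ m / be u ^ n"
      by (simp add: algebra_simps diff_divide_distrib add_divide_distrib)
    thus ?case using posd[OF elim] elim by (simp add: power_divide)
  qed
  ultimately have "((\<lambda>u. (h (om u) - h (- be u)) * u ^ k * u ^ m / u ^ n) \<longlongrightarrow>
      (- B * (real m - real n) + - ((real n + 1) * A' + B')) * 1 ^ n / (1 ^ k * 1 ^ m)) at_top"
    by (rule Lim_transform_eventually)
  thus ?thesis by (simp add: algebra_simps)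
qed

section \<open>Orbits of the slow relation\<close>

lemma I_minus_inject: "0 \<le> y \<Longrightarrow> 0 \<le> z \<Longrightarrow> I_minus F G y = I_minus F G z \<longleftrightarrow> y = z"
  using I_minus_strict_antimono by (metis less_irrefl linorder_neqE_linordered_idom)

lemma I_plus_inject: "0 \<le> y \<Longrightarrow> 0 \<le> z \<Longrightarrow> I_plus F G y = I_plus F G z \<longleftrightarrow> y = z"
  using lienard_side.I_minus_inject[OF reflected] by (simp add: I_plus_eq)

lemma I_plus_nonpos: "0 \<le> y \<Longrightarrow> I_plus F G y \<le> 0"
  using lienard_side.I_minus_nonpos[OF reflected] by (simp add: I_plus_eq)

lemma slow_relation_spec:
  assumes "0 \<le> y"
  shows "0 \<le> slow_relation F G y \<and> I_plus F G (slow_relation F G y) = I_minus F G y"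
proof -
  obtain z where "0 \<le> z" "I_minus F G y = I_plus F G z"
    using lienard_side.I_minus_surj[OF reflected I_minus_nonpos[OF assms]] I_plus_eq by metis
  hence "\<exists>!z. z \<ge> 0 \<and> I_minus F G y = I_plus F G z"
    using I_plus_inject by (intro ex1I[of _ z]) auto
  from theI'[OF this] show ?thesis unfolding slow_relation_def by simp
qed

text \<open>\<open>inv_into\<close> inverts on the image of [0, infinity), and that image contains y
  because \<open>I_minus\<close> attains the nonpositive value \<open>I_plus F G y\<close>.\<close>

lemma slow_relation_inv_spec:
  assumes "0 \<le> y"
  shows "0 \<le> slow_relation_inv F G y \<and> I_minus F G (slow_relation_inv F G y) = I_plus F G y"
proof -
  obtain x where x: "0 \<le> x" "I_minus F G x = I_plus F G y"
    using I_minus_surj[OF I_plus_nonpos[OF assms]] by metis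
  have "slow_relation F G x = y"
    using slow_relation_spec[OF x(1)] x(2) I_plus_inject[OF _ assms] by auto
  hence "y \<in> slow_relation F G ` {0..}" using x by auto
  hence "slow_relation_inv F G y \<in> {0..}" "slow_relation F G (slow_relation_inv F G y) = y"
    unfolding slow_relation_inv_def by (rule inv_into_into, rule f_inv_into_f)
  thus ?thesis using slow_relation_spec[of "slow_relation_inv F G y"] by simp
qed

definition p :: nat where "p = 2 * n + 1 - m"

definition W :: "real \<Rightarrow> real" where "W u = slow_div_integral F G (u ^ Suc n)"

lemma \<psi>_strict_antimono: "0 \<le> u \<Longrightarrow> u < v \<Longrightarrow> \<psi> v < \<psi> u"
  unfolding \<psi>_def by (rule I_minus_strict_antimono) (auto intro: power_strict_mono simp del: power_Suc)

lemma W_eq: "W u = \<psi> u - lienard_side.\<psi> (reflect F) (- reflect G) n u"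
proof -
  interpret R: lienard_side "reflect F" "- reflect G" "reflect P" "reflect Q" n m by (rule reflected)
  \<comment> \<open>As n + 1 is even this holds for negative u too, so the identity needs no
    guard.\<close>
  have "0 \<le> u ^ Suc n" using odd_n by (simp add: zero_le_even_power del: power_Suc)
  thus ?thesis by (simp add: W_def slow_div_integral_def \<psi>_def R.\<psi>_def I_plus_eq del: power_Suc)
qed

text \<open>From I_+(S(y)) = I_-(y) the new point is read off I_+, so the reflected
  \<open>\<psi>\<close> plays the role of \<open>\<psi>\<close> in \<open>orbit_step_bounds\<close>.
  The exponent k is free: it is the order of the asymmetry when -I has order u^(p-k), and p when I
  tends to a nonzero limit.\<close>

lemma large_orbits_slow_relation:
  assumes k: "1 \<le> k" and d1: "0 < d1"
    and bounds: "eventually (\<lambda>u. d1 * u ^ p \<le> - W u * u ^ k \<and> - W u * u ^ k \<le> d2 * u ^ p) at_top"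
  shows "large_orbits_mono n (slow_relation F G) (real k / (real k + 1))"
proof -
  interpret R: lienard_side "reflect F" "- reflect G" "reflect P" "reflect Q" n m by (rule reflected)
  have p: "p = Suc (2 * n - m)" using m_less by (simp add: p_def)
  define \<tau> where "\<tau> u = root (n + 1) (slow_relation F G (u ^ (n + 1)))" for u
  have \<tau>: "0 \<le> \<tau> u \<and> R.\<psi> (\<tau> u) = \<psi> u" if "0 < u" for u
  proof -
    have "0 \<le> u ^ (n + 1)" using that by simp
    from slow_relation_spec[OF this] show ?thesis
      by (auto simp: \<tau>_def R.\<psi>_def \<psi>_def I_plus_eq simp del: power_Suc)
  qed
  have "eventually (\<lambda>u. d1 * u ^ Suc (2 * n - m) \<le> (R.\<psi> u - \<psi> u) * u ^ k \<and> (R.\<psi> u - \<psi> u) * u ^ k \<le> d2 * u ^ Suc (2 * n - m)) at_top"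
    using bounds by (simp add: W_eq p del: power_Suc)
  from orbit_step_bounds[OF k R.DERIV_\<psi> R.\<psi>_asymp _ R.\<psi>_strict_antimono \<tau> d1 this]
  obtain c1 c2 where "0 < c1" "eventually (\<lambda>u. c1 \<le> (\<tau> u - u) * u ^ (k - 1) \<and> (\<tau> u - u) * u ^ (k - 1) \<le> c2) at_top"
    by auto
  from large_orbits_mono_of_step_bounds[OF k this[unfolded \<tau>_def]] show ?thesis .
qed

lemma large_orbits_slow_relation_inv:
  assumes k: "1 \<le> k" and d1: "0 < d1"
    and bounds: "eventually (\<lambda>u. d1 * u ^ p \<le> W u * u ^ k \<and> W u * u ^ k \<le> d2 * u ^ p) at_top"
  shows "large_orbits_mono n (slow_relation_inv F G) (real k / (real k + 1))"
proof -
  interpret R: lienard_side "reflect F" "- reflect G" "reflect P" "reflect Q" n m by (rule reflected)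
  have p: "p = Suc (2 * n - m)" using m_less by (simp add: p_def)
  define \<tau> where "\<tau> u = root (n + 1) (slow_relation_inv F G (u ^ (n + 1)))" for u
  have \<tau>: "0 \<le> \<tau> u \<and> \<psi> (\<tau> u) = R.\<psi> u" if "0 < u" for u
  proof -
    have "0 \<le> u ^ (n + 1)" using that by simp
    from slow_relation_inv_spec[OF this] this show ?thesis
      by (auto simp: \<tau>_def R.\<psi>_def \<psi>_def I_plus_eq simp del: power_Suc)
  qed
  have "eventually (\<lambda>u. d1 * u ^ Suc (2 * n - m) \<le> (\<psi> u - R.\<psi> u) * u ^ k \<and> (\<psi> u - R.\<psi> u) * u ^ k \<le> d2 * u ^ Suc (2 * n - m)) at_top"
    using bounds by (simp add: W_eq p del: power_Suc)
  from orbit_step_bounds[OF k DERIV_\<psi> \<psi>_asymp _ \<psi>_strict_antimono \<tau> d1 this]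
  obtain c1 c2 where "0 < c1" "eventually (\<lambda>u. c1 \<le> (\<tau> u - u) * u ^ (k - 1) \<and> (\<tau> u - u) * u ^ (k - 1) \<le> c2) at_top"
    by auto
  from large_orbits_mono_of_step_bounds[OF k this[unfolded \<tau>_def]] show ?thesis .
qed

definition W' :: "real \<Rightarrow> real" where
  "W' u = (real n + 1) * u ^ n * (h (om u) - h (- be u))"

lemma DERIV_W:
  assumes "0 < u"
  shows "(W has_real_derivative W' u) (at u)"
proof -
  interpret R: lienard_side "reflect F" "- reflect G" "reflect P" "reflect Q" n m by (rule reflected)
  have "R.h (R.om u) = h (- be u)" by (simp add: R.h_def h_def R.om_def be_def)
  with DERIV_diff[OF DERIV_\<psi>[OF assms] R.DERIV_\<psi>[OF assms]] show ?thesis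
    by (simp add: W_eq[abs_def] W'_def algebra_simps)
qed

lemma bounds_powr_to_power:
  assumes "eventually (\<lambda>u. c1 * u powr (real p - real k) \<le> f u \<and> f u \<le> c2 * u powr (real p - real k)) at_top"
  shows "eventually (\<lambda>u. c1 * u ^ p \<le> f u * u ^ k \<and> f u * u ^ k \<le> c2 * u ^ p) at_top"
  using assms eventually_gt_at_top[of 0]
proof eventually_elim
  case (elim u)
  have "u ^ p = u powr (real p - real k) * u ^ k" 
    using elim(2) by (simp add: powr_diff powr_realpow)
  thus ?case using elim by (simp flip: mult.assoc)
qed

lemma W_at_infinity:
  assumes "filterlim W Fl at_top"
  shows "filterlim (slow_div_integral F G) Fl at_top"
  using filterlim_at_top_of_power[of "slow_div_integral F G" n Fl] assms by (simp add: W_def[abs_def] del: power_Suc)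

section \<open>Behaviour of I and of the orbits for asymmetry of order k with coefficient c\<close>

context
  fixes k :: nat and c :: real
  assumes k: "1 \<le> k"
    and h_diff: "((\<lambda>u. (h (om u) - h (- be u)) * u ^ k * u ^ m / u ^ n) \<longlongrightarrow> - c) at_top"
begin

lemma W'_asymp: "((\<lambda>u. W' u * u powr (1 - (real p - real k))) \<longlongrightarrow> - ((real n + 1) * c)) at_top"
proof -
  have "((\<lambda>u. (real n + 1) * ((h (om u) - h (- be u)) * u ^ k * u ^ m / u ^ n)) \<longlongrightarrow> (real n + 1) * - c) at_top"
    by (intro tendsto_intros h_diff)
  moreover have "eventually (\<lambda>u. (real n + 1) * ((h (om u) - h (- be u)) * u ^ k * u ^ m / u ^ n) =
      W' u * u powr (1 - (real p - real k))) at_top"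
    using eventually_gt_at_top[of 0]
  proof eventually_elim
    case (elim u)
    have "real p = 2 * real n + 1 - real m" using m_less by (simp add: p_def of_nat_diff)
    hence "1 - (real p - real k) = real (k + m) - real (n + n)" by simp
    hence "u powr (1 - (real p - real k)) = u powr real (k + m) / u powr real (n + n)"
      by (simp only: powr_diff)
    also have "\<dots> = u ^ k * u ^ m / (u ^ n * u ^ n)"
      using elim by (simp only: powr_realpow power_add)
    finally show ?case using elim by (simp add: W'_def)
  qed
  ultimately have "((\<lambda>u. W' u * u powr (1 - (real p - real k))) \<longlongrightarrow> (real n + 1) * - c) at_top"
    by (rule Lim_transform_eventually)
  thus ?thesis by simp
qed

lemma minus_W'_asymp: "((\<lambda>u. - W' u * u powr (1 - (real p - real k))) \<longlongrightarrow> (real n + 1) * c) at_top"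
  using tendsto_minus[OF W'_asymp] by simp

lemma divergent_pos:
  assumes "k < p" "0 < c"
  shows "filterlim (slow_div_integral F G) at_bot at_top \<and>
    large_orbits_mono n (slow_relation F G) (real k / (real k + 1))"
proof -
  have q: "0 < real p - real k" using assms by simp
  obtain c1 c2 where c1: "0 < c1"
    and b: "eventually (\<lambda>u. c1 * u powr (real p - real k) \<le> - W u \<and> - W u \<le> c2 * u powr (real p - real k)) at_top"
    using antiderivative_growth[OF DERIV_minus[OF DERIV_W] minus_W'_asymp _ q] assms by auto
  have "filterlim (\<lambda>u. c1 * u powr (real p - real k)) at_top at_top" using c1 q by real_asymp
  hence "filterlim (\<lambda>u. - W u) at_top at_top"
    by (rule filterlim_at_top_mono) (use b in \<open>auto elim: eventually_mono\<close>)
  hence "filterlim (slow_div_integral F G) at_bot at_top"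
    by (intro W_at_infinity) (simp add: filterlim_uminus_at_bot)
  thus ?thesis using large_orbits_slow_relation[OF k c1 bounds_powr_to_power[OF b]] by blast
qed

lemma divergent_neg:
  assumes "k < p" "c < 0"
  shows "filterlim (slow_div_integral F G) at_top at_top \<and>
    large_orbits_mono n (slow_relation_inv F G) (real k / (real k + 1))"
proof -
  have q: "0 < real p - real k" using assms by simp
  have "0 < - ((real n + 1) * c)" using assms by (simp add: mult_pos_neg)
  then obtain c1 c2 where c1: "0 < c1"
    and b: "eventually (\<lambda>u. c1 * u powr (real p - real k) \<le> W u \<and> W u \<le> c2 * u powr (real p - real k)) at_top"
    using antiderivative_growth[OF DERIV_W W'_asymp _ q] by auto
  have "filterlim (\<lambda>u. c1 * u powr (real p - real k)) at_top at_top" using c1 q by real_asymp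
  hence "filterlim W at_top at_top"
    by (rule filterlim_at_top_mono) (use b in \<open>auto elim: eventually_mono\<close>)
  thus ?thesis using large_orbits_slow_relation_inv[OF k c1 bounds_powr_to_power[OF b]] W_at_infinity by blast
qed

text \<open>The sign of c decides whether \<open>W\<close> increases or decreases to its limit, so
  the tail lemma is applied to \<open>W\<close> or to \<open>- W\<close>. A zero limit leaves a tail
  of order u^(p-k); a nonzero limit makes \<open>W\<close> of order 1, which is the bound with k
  replaced by p.\<close>

lemma convergent:
  assumes "p < k" "c \<noteq> 0"
  shows "\<exists>I_star. (slow_div_integral F G \<longlongrightarrow> I_star) at_top \<and>
    (I_star < 0 \<longrightarrow> large_orbits_mono n (slow_relation F G) (real p / (real p + 1))) \<and>
    (I_star > 0 \<longrightarrow> large_orbits_mono n (slow_relation_inv F G) (real p / (real p + 1))) \<and>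
    (I_star = 0 \<longrightarrow>
      (c < 0 \<longrightarrow> large_orbits_mono n (slow_relation F G) (real k / (real k + 1))) \<and>
      (c > 0 \<longrightarrow> large_orbits_mono n (slow_relation_inv F G) (real k / (real k + 1))))"
proof -
  have q: "real p - real k < 0" using assms by simp
  have p1: "1 \<le> p" using m_less by (simp add: p_def)
  have "\<exists>L. (W \<longlongrightarrow> L) at_top \<and> (L = 0 \<longrightarrow>
      (c < 0 \<longrightarrow> large_orbits_mono n (slow_relation F G) (real k / (real k + 1))) \<and>
      (c > 0 \<longrightarrow> large_orbits_mono n (slow_relation_inv F G) (real k / (real k + 1))))"
  proof (cases "c < 0")
    case True
    hence "0 < - ((real n + 1) * c)" by (simp add: mult_pos_neg)
    then obtain L c1 c2 where L: "(W \<longlongrightarrow> L) at_top" and c1: "0 < c1"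
      and b: "eventually (\<lambda>u. c1 * u powr (real p - real k) \<le> L - W u \<and> L - W u \<le> c2 * u powr (real p - real k)) at_top"
      using antiderivative_tail[OF DERIV_W W'_asymp _ q] by auto
    show ?thesis
    proof (intro exI[of _ L] conjI impI L)
      assume "L = 0"
      with b have "eventually (\<lambda>u. c1 * u powr (real p - real k) \<le> - W u \<and> - W u \<le> c2 * u powr (real p - real k)) at_top" by simp
      from large_orbits_slow_relation[OF k c1 bounds_powr_to_power[OF this]]
      show "large_orbits_mono n (slow_relation F G) (real k / (real k + 1))" .
    qed (use True in auto)
  next
    case False
    hence "0 < (real n + 1) * c" using assms by simp
    then obtain L c1 c2 where L: "((\<lambda>u. - W u) \<longlongrightarrow> L) at_top" and c1: "0 < c1"
      and b: "eventually (\<lambda>u. c1 * u powr (real p - real k) \<le> L - - W u \<and> L - - W u \<le> c2 * u powr (real p - real k)) at_top"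
      using antiderivative_tail[OF DERIV_minus[OF DERIV_W] minus_W'_asymp _ q] by auto
    have L': "(W \<longlongrightarrow> - L) at_top" using tendsto_minus[OF L] by simp
    show ?thesis
    proof (intro exI[of _ "- L"] conjI impI L')
      assume "- L = 0"
      with b have "eventually (\<lambda>u. c1 * u powr (real p - real k) \<le> W u \<and> W u \<le> c2 * u powr (real p - real k)) at_top" by simp
      from large_orbits_slow_relation_inv[OF k c1 bounds_powr_to_power[OF this]]
      show "large_orbits_mono n (slow_relation_inv F G) (real k / (real k + 1))" .
    qed (use False in auto)
  qed
  then obtain L where L: "(W \<longlongrightarrow> L) at_top" and L0: "L = 0 \<longrightarrow>
      (c < 0 \<longrightarrow> large_orbits_mono n (slow_relation F G) (real k / (real k + 1))) \<and>
      (c > 0 \<longrightarrow> large_orbits_mono n (slow_relation_inv F G) (real k / (real k + 1)))" by blast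
  have neg: "large_orbits_mono n (slow_relation F G) (real p / (real p + 1))" if "L < 0"
  proof -
    have "eventually (\<lambda>u. 2 * L < W u \<and> W u < L / 2 \<and> 0 \<le> u) at_top"
      using that by (intro eventually_conj order_tendstoD[OF L] eventually_ge_at_top) auto
    hence "eventually (\<lambda>u. - L / 2 * u ^ p \<le> - W u * u ^ p \<and> - W u * u ^ p \<le> (- 2 * L) * u ^ p) at_top"
      by eventually_elim (intro conjI mult_right_mono, auto)
    from large_orbits_slow_relation[OF p1 _ this] that show ?thesis by simp
  qed
  have pos: "large_orbits_mono n (slow_relation_inv F G) (real p / (real p + 1))" if "0 < L"
  proof -
    have "eventually (\<lambda>u. L / 2 < W u \<and> W u < 2 * L \<and> 0 \<le> u) at_top"
      using that by (intro eventually_conj order_tendstoD[OF L] eventually_ge_at_top) auto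
    hence "eventually (\<lambda>u. L / 2 * u ^ p \<le> W u * u ^ p \<and> W u * u ^ p \<le> (2 * L) * u ^ p) at_top"
      by eventually_elim (intro conjI mult_right_mono, auto)
    from large_orbits_slow_relation_inv[OF p1 _ this] that show ?thesis by simp
  qed
  from L0 neg pos W_at_infinity[OF L] show ?thesis by blast
qed

end

end

section \<open>Leading asymmetric coefficients\<close>

text \<open>The limit of p(x) / x^d at plus infinity gives the sign; at minus infinity an odd d
  would force the opposite sign.\<close>

lemma positive_poly_leading_coeff:
  fixes p :: "real poly"
  assumes pos: "\<And>x. 0 < poly p x" and deg: "\<And>i. d < i \<Longrightarrow> coeff p i = 0" and lead: "coeff p d \<noteq> 0"
  shows "0 < coeff p d" and "even d"
proof -
  note lim = tendsto_poly_div_power[OF deg]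
  have "0 \<le> coeff p d"
    by (rule tendsto_lowerbound[OF tendsto_mono[OF at_top_le_at_infinity lim]])
       (use pos in \<open>auto intro!: eventually_mono[OF eventually_gt_at_top[of 0]] simp: less_imp_le\<close>)
  thus *: "0 < coeff p d" using lead by simp
  show "even d"
  proof (rule ccontr)
    assume "odd d"
    have "poly p x / x ^ d \<le> 0" if "x < 0" for x
      using that pos[of x] \<open>odd d\<close> by (simp add: divide_pos_neg less_imp_le power_less_zero_eq)
    hence "eventually (\<lambda>x. poly p x / x ^ d \<le> 0) at_bot"
      by (intro eventually_mono[OF eventually_gt_at_bot[of 0]])
    hence "coeff p d \<le> 0"
      by (intro tendsto_upperbound[OF tendsto_mono[OF at_bot_le_at_infinity lim]]) auto
    thus False using * by simp
  qed
qed

lemma coeff_lienard_F: "coeff (lienard_F n b) i = (if i = n + 1 then 1 else if i \<le> n then b i else 0)"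
  by (auto simp: lienard_F_def coeff_sum sum.delta)

lemma coeff_lienard_G: "coeff (lienard_G m A a) i = (if i = m then - A else if i < m then - a i else 0)"
  by (auto simp: lienard_G_def coeff_sum sum.delta)

text \<open>Positivity of \<open>P\<close> and \<open>- Q\<close>, of degrees n - 1 and m - 1, makes
  these degrees even and A positive, after which the normalization leaves A = 1.\<close>

lemma lienard_side_of_admissible:
  assumes "1 \<le> m" "1 \<le> n" and norm: "lienard_normalized m n A"
    and adm: "lienard_admissible (lienard_F n b) (lienard_G m A a)" and "m < 2 * n + 1"
  obtains P Q where "lienard_side (lienard_F n b) (lienard_G m A a) P Q n m"
proof -
  define F G where "F = lienard_F n b" and "G = lienard_G m A a"
  define P Q where "P = pderiv F div [:0, 1:]" and "Q = G div [:0, 1:]"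
  have adm': "poly F 0 = 0" "poly (pderiv F) 0 = 0" "poly G 0 = 0" "\<And>x. 0 < poly P x" "\<And>x. poly Q x < 0"
    using adm by (auto simp: lienard_admissible_def F_def G_def P_def Q_def)
  have P: "pderiv F = [:0, 1:] * P" and Q: "G = [:0, 1:] * Q"
    using adm'(2,3) unfolding P_def Q_def poly_eq_0_iff_dvd minus_zero
    by (simp_all only: dvd_mult_div_cancel)
  have cP: "coeff P i = coeff (pderiv F) (Suc i)" and cQ: "coeff Q i = coeff G (Suc i)" for i
    by (simp_all add: P Q)
  have "even (n - 1)"
    by (rule positive_poly_leading_coeff(2)[of P])
       (use \<open>1 \<le> n\<close> adm'(4) in \<open>auto simp: cP coeff_pderiv F_def coeff_lienard_F\<close>)
  have A: "A \<noteq> 0" "even m \<Longrightarrow> A = 1" "odd m \<Longrightarrow> A = 1 \<or> A = - 1"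
    using norm \<open>m < 2 * n + 1\<close> by (auto simp: lienard_normalized_def)
  have "0 < coeff (- Q) (m - 1)" "even (m - 1)"
    by (rule positive_poly_leading_coeff[of "- Q"];
        use \<open>1 \<le> m\<close> adm'(5) A(1) in \<open>auto simp: cQ G_def coeff_lienard_G\<close>)+
  hence "odd m" "0 < A" using \<open>1 \<le> m\<close> by (auto simp: cQ G_def coeff_lienard_G)
  hence "A = 1" using A by auto
  have "coeff F i = 0" if "n + 1 < i" for i using that by (simp add: F_def coeff_lienard_F)
  moreover have "coeff F (n + 1) = 1" by (simp add: F_def coeff_lienard_F)
  moreover have "coeff G i = 0" if "m < i" for i using that by (simp add: G_def coeff_lienard_G)
  moreover have "coeff G m = - 1" using \<open>A = 1\<close> by (simp add: G_def coeff_lienard_G)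
  moreover have "odd n" using \<open>even (n - 1)\<close> \<open>1 \<le> n\<close> by auto
  ultimately have "lienard_side F G P Q n m"
    using P Q adm'(1,4,5) \<open>odd m\<close> \<open>m < 2 * n + 1\<close> by (intro lienard_side.intro)
  thus thesis using that by (simp add: F_def G_def)
qed

context lienard_side
begin

text \<open>Multiplying the odd part of F and the even part of G by x^k lifts them to degree at most
  n + 1 and m, so the three limits are single coefficients. F' contributes with the extra factor n +
  1 - k from differentiation, and the overall 2 comes from adding reflections.\<close>

lemma h_difference_asymp_coeffs:
  assumes k: "odd k"
    and B0: "\<And>i. odd i \<Longrightarrow> n + 1 < i + k \<Longrightarrow> coeff F i = 0"
    and A0: "\<And>i. even i \<Longrightarrow> m < i + k \<Longrightarrow> coeff G i = 0"
  defines "B \<equiv> if k \<le> n then coeff F (n + 1 - k) else 0"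
    and "A \<equiv> if k \<le> m then coeff G (m - k) else 0"
  shows "((\<lambda>u. (h (om u) - h (- be u)) * u ^ k * u ^ m / u ^ n) \<longlongrightarrow>
      - (2 * (B * (real m + 1 - real k) + A * (real n + 1)))) at_top"
proof -
  \<comment> \<open>Parity excludes k = n + 1, so the guard \<open>k \<le> n\<close> in
    \<open>B\<close> agrees with the guard k <= n + 1 of the product with
    \<open>monom 1 k\<close>.\<close>
  have kn: "k \<noteq> n + 1" using k odd_n by auto
  define q where "q = F - reflect F"
  have cq: "coeff q i = (if odd i then 2 * coeff F i else 0)" for i
    by (auto simp: q_def coeff_reflect)
  have cg: "coeff (G + reflect G) i = (if even i then 2 * coeff G i else 0)" for i
    by (auto simp: coeff_reflect)
  have "((\<lambda>x. poly (monom 1 k * q) x / x ^ (n + 1)) \<longlongrightarrow> coeff (monom 1 k * q) (n + 1)) at_infinity"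
    by (rule tendsto_poly_div_power) (use B0 in \<open>auto simp: coeff_monom_mult cq\<close>)
  moreover have "coeff (monom 1 k * q) (n + 1) = 2 * B"
    using k odd_n kn by (auto simp: coeff_monom_mult cq B_def)
  ultimately have oF: "((\<lambda>x. (poly F x - poly F (- x)) * x ^ k / x ^ (n + 1)) \<longlongrightarrow> 2 * B) at_infinity"
    by (simp add: q_def poly_monom mult.commute)
  have "((\<lambda>x. poly (monom 1 k * pderiv q) x / x ^ n) \<longlongrightarrow> coeff (monom 1 k * pderiv q) n) at_infinity"
    by (rule tendsto_poly_div_power) (use B0 in \<open>auto simp: coeff_monom_mult coeff_pderiv cq\<close>)
  moreover have "coeff (monom 1 k * pderiv q) n = 2 * (real n + 1 - real k) * B"
    using k odd_n kn by (auto simp: coeff_monom_mult coeff_pderiv cq B_def Suc_diff_le of_nat_diff)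
  ultimately have F': "((\<lambda>x. (poly (pderiv F) x + poly (pderiv F) (- x)) * x ^ k / x ^ n) \<longlongrightarrow>
      2 * (real n + 1 - real k) * B) at_infinity"
    by (simp add: q_def poly_monom mult.commute pderiv_diff pderiv_reflect)
  have "((\<lambda>x. poly (monom 1 k * (G + reflect G)) x / x ^ m) \<longlongrightarrow> coeff (monom 1 k * (G + reflect G)) m) at_infinity"
    by (rule tendsto_poly_div_power) (use A0 in \<open>auto simp: coeff_monom_mult cg simp del: coeff_add\<close>)
  moreover have "coeff (monom 1 k * (G + reflect G)) m = 2 * A"
    using k odd_m by (auto simp: coeff_monom_mult cg A_def simp del: coeff_add)
  ultimately have G': "((\<lambda>x. (poly G x + poly G (- x)) * x ^ k / x ^ m) \<longlongrightarrow> 2 * A) at_infinity"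
    by (simp add: poly_monom mult.commute)
  have "2 * B * (real m - real n) + (real n + 1) * (2 * A) + 2 * (real n + 1 - real k) * B =
      2 * (B * (real m + 1 - real k) + A * (real n + 1))"
    by (simp add: algebra_simps)
  with h_difference_asymp[OF oF F' G'] show ?thesis by (simp only:)
qed

end

text \<open>Common form of all three cases: k is the order of the leading asymmetry and c its
  coefficient. The minus sign in c is that of the coefficients -a of G.\<close>

lemma lienard_orbits:
  fixes k :: nat and A c :: real
  assumes mn: "1 \<le> m" "1 \<le> n" "m < 2 * n + 1"
    and adm: "lienard_normalized m n A" "lienard_admissible (lienard_F n b) (lienard_G m A a)"
    and k: "odd k" 
    and B0: "\<forall>i. odd i \<and> i \<le> n \<and> n + 1 < i + k \<longrightarrow> b i = 0"
    and A0: "\<forall>i. even i \<and> i < m \<and> m < i + k \<longrightarrow> a i = 0"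
    and c: "c = (if k \<le> n then b (n + 1 - k) else 0) * (real m + 1 - real k) -
      (if k \<le> m then a (m - k) else 0) * (real n + 1)"
  defines "I \<equiv> slow_div_integral (lienard_F n b) (lienard_G m A a)"
    and "S \<equiv> slow_relation (lienard_F n b) (lienard_G m A a)"
    and "S_inv \<equiv> slow_relation_inv (lienard_F n b) (lienard_G m A a)"
  shows "k + m < 2 * n + 1 \<Longrightarrow> 0 < c \<Longrightarrow>
      filterlim I at_bot at_top \<and> large_orbits_mono n S (real k / (real k + 1))"
    and "k + m < 2 * n + 1 \<Longrightarrow> c < 0 \<Longrightarrow>
      filterlim I at_top at_top \<and> large_orbits_mono n S_inv (real k / (real k + 1))"
    and "2 * n + 1 < k + m \<Longrightarrow> c \<noteq> 0 \<Longrightarrow> \<exists>I_star. (I \<longlongrightarrow> I_star) at_top \<and>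
      (I_star < 0 \<longrightarrow> large_orbits n S ((2 * real n + 1 - real m) / (2 * real n + 2 - real m))) \<and>
      (I_star > 0 \<longrightarrow> large_orbits n S_inv ((2 * real n + 1 - real m) / (2 * real n + 2 - real m))) \<and>
      (I_star = 0 \<longrightarrow>
        (c < 0 \<longrightarrow> large_orbits n S (real k / (real k + 1))) \<and>
        (c > 0 \<longrightarrow> large_orbits n S_inv (real k / (real k + 1))))"
proof -
  obtain P Q where "lienard_side (lienard_F n b) (lienard_G m A a) P Q n m"
    using lienard_side_of_admissible[OF mn(1,2) adm mn(3)] .
  then interpret lienard_side "lienard_F n b" "lienard_G m A a" P Q n m .
  have k1: "1 \<le> k" using k by (cases k) auto
  have "coeff (lienard_F n b) i = 0" if "odd i" "n + 1 < i + k" for i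
    using that B0 odd_n k1 by (auto simp: coeff_lienard_F)
  moreover have "coeff (lienard_G m A a) i = 0" if "even i" "m < i + k" for i
    using that A0 odd_m by (auto simp: coeff_lienard_G)
  ultimately have "((\<lambda>u. (h (om u) - h (- be u)) * u ^ k * u ^ m / u ^ n) \<longlongrightarrow>
    - (2 * ((if k \<le> n then coeff (lienard_F n b) (n + 1 - k) else 0) * (real m + 1 - real k) +
       (if k \<le> m then coeff (lienard_G m A a) (m - k) else 0) * (real n + 1)))) at_top"
    by (rule h_difference_asymp_coeffs[OF k])
  moreover have "(if k \<le> n then coeff (lienard_F n b) (n + 1 - k) else 0) * (real m + 1 - real k) +
       (if k \<le> m then coeff (lienard_G m A a) (m - k) else 0) * (real n + 1) = c"
    using k1 mn(1) by (auto simp: c coeff_lienard_F coeff_lienard_G)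
  ultimately have lim: "((\<lambda>u. (h (om u) - h (- be u)) * u ^ k * u ^ m / u ^ n) \<longlongrightarrow> - (2 * c)) at_top"
    by (simp only:)
  have "real p = 2 * real n + 1 - real m" using m_less by (simp add: p_def of_nat_diff)
  hence p: "(k < p) = (k + m < 2 * n + 1)" "(p < k) = (2 * n + 1 < k + m)"
    "real p / (real p + 1) = (2 * real n + 1 - real m) / (2 * real n + 2 - real m)"
    using m_less by (auto simp: p_def add.commute diff_add_eq)
  show "filterlim I at_bot at_top \<and> large_orbits_mono n S (real k / (real k + 1))"
    if "k + m < 2 * n + 1" "0 < c"
    using divergent_pos[OF k1 lim] that by (simp add: p I_def S_def)
  show "filterlim I at_top at_top \<and> large_orbits_mono n S_inv (real k / (real k + 1))"
    if "k + m < 2 * n + 1" "c < 0"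
    using divergent_neg[OF k1 lim] that by (simp add: p I_def S_inv_def)
  show "\<exists>I_star. (I \<longlongrightarrow> I_star) at_top \<and>
      (I_star < 0 \<longrightarrow> large_orbits n S ((2 * real n + 1 - real m) / (2 * real n + 2 - real m))) \<and>
      (I_star > 0 \<longrightarrow> large_orbits n S_inv ((2 * real n + 1 - real m) / (2 * real n + 2 - real m))) \<and>
      (I_star = 0 \<longrightarrow>
        (c < 0 \<longrightarrow> large_orbits n S (real k / (real k + 1))) \<and>
        (c > 0 \<longrightarrow> large_orbits n S_inv (real k / (real k + 1))))"
    if "2 * n + 1 < k + m" "c \<noteq> 0"
  proof -
    from convergent[OF k1 lim] that p(2)
    obtain L where "(I \<longlongrightarrow> L) at_top"
      "L < 0 \<longrightarrow> large_orbits_mono n S (real p / (real p + 1))"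
      "L > 0 \<longrightarrow> large_orbits_mono n S_inv (real p / (real p + 1))"
      "L = 0 \<longrightarrow> (c < 0 \<longrightarrow> large_orbits_mono n S (real k / (real k + 1))) \<and>
        (c > 0 \<longrightarrow> large_orbits_mono n S_inv (real k / (real k + 1)))"
      unfolding I_def S_def S_inv_def by (auto simp: zero_less_mult_iff mult_less_0_iff)
    thus ?thesis unfolding p(3) using large_orbits_mono_imp_large_orbits by blast
  qed
qed

lemma lienard_odd_degrees:
  assumes "1 \<le> m" "1 \<le> n" "lienard_normalized m n A"
    "lienard_admissible (lienard_F n b) (lienard_G m A a)" "m < 2 * n + 1"
  shows "odd n" "odd m"
proof -
  obtain P Q where "lienard_side (lienard_F n b) (lienard_G m A a) P Q n m"
    using lienard_side_of_admissible[OF assms] .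
  thus "odd n" "odd m" by (simp_all add: lienard_side_def)
qed

theorem theorem2p1:
  fixes m n j_a j_b :: nat and A C :: real and a b :: "nat \<Rightarrow> real"
    and F G :: "real poly" and I S S_inv :: "real \<Rightarrow> real"
    and j_a_defined j_b_defined :: bool
  assumes "m \<ge> 1" and "n \<ge> 1"
    and "lienard_normalized m n A"
    and F: "F = lienard_F n b"
    and G: "G = lienard_G m A a"
    and "lienard_admissible F G"
    and I: "I = slow_div_integral F G"
    and S: "S = slow_relation F G"
    and S_inv: "S_inv = slow_relation_inv F G"
    and j_a_defined: "j_a_defined \<longleftrightarrow> even_indices m a \<noteq> {}"
    and j_b_defined: "j_b_defined \<longleftrightarrow> odd_indices n b \<noteq> {}"
    and j_a: "j_a_defined \<Longrightarrow> j_a = Max (even_indices m a)"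
    and j_b: "j_b_defined \<Longrightarrow> j_b = Max (odd_indices n b)"
    and "j_a_defined \<or> j_b_defined"
    and "m < 2 * n + 1"
    and C: "C = b (2 * j_b + 1) * (real m - real n + 2 * real j_b + 1) - a (2 * j_a) * (real n + 1)"
  shows
    "((j_a_defined \<and> j_b_defined \<and> int n - 2 * int j_b < int m - 2 * int j_a) \<or> \<not> j_a_defined \<longrightarrow>
         (int m - int n - 2 * int j_b - 1 < 0 \<longrightarrow>
            (b (2 * j_b + 1) * (real m - real n + 2 * real j_b + 1) > 0 \<longrightarrow>
               filterlim I at_bot at_top \<and> large_orbits_mono n S ((real n - 2 * real j_b) / (real n + 1 - 2 * real j_b))) \<and>
            (b (2 * j_b + 1) * (real m - real n + 2 * real j_b + 1) < 0 \<longrightarrow>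
               filterlim I at_top at_top \<and> large_orbits_mono n S_inv ((real n - 2 * real j_b) / (real n + 1 - 2 * real j_b)))) \<and>
         (int m - int n - 2 * int j_b - 1 > 0 \<longrightarrow>
            (\<exists>I_star. (I \<longlongrightarrow> I_star) at_top \<and>
               (I_star < 0 \<longrightarrow> large_orbits n S ((2 * real n + 1 - real m) / (2 * real n + 2 - real m))) \<and>
               (I_star > 0 \<longrightarrow> large_orbits n S_inv ((2 * real n + 1 - real m) / (2 * real n + 2 - real m))) \<and>
               (I_star = 0 \<longrightarrow>
                  (b (2 * j_b + 1) < 0 \<longrightarrow> large_orbits n S ((real n - 2 * real j_b) / (real n + 1 - 2 * real j_b))) \<and>
                  (b (2 * j_b + 1) > 0 \<longrightarrow> large_orbits n S_inv ((real n - 2 * real j_b) / (real n + 1 - 2 * real j_b)))))))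
     \<and>
     ((j_a_defined \<and> j_b_defined \<and> int n - 2 * int j_b > int m - 2 * int j_a) \<or> \<not> j_b_defined \<longrightarrow>
         (2 * int m - 2 * int n - 2 * int j_a - 1 < 0 \<longrightarrow>
            (a (2 * j_a) < 0 \<longrightarrow>
               filterlim I at_bot at_top \<and> large_orbits n S ((real m - 2 * real j_a) / (real m + 1 - 2 * real j_a))) \<and>
            (a (2 * j_a) > 0 \<longrightarrow>
               filterlim I at_top at_top \<and> large_orbits n S_inv ((real m - 2 * real j_a) / (real m + 1 - 2 * real j_a)))) \<and>
         (2 * int m - 2 * int n - 2 * int j_a - 1 > 0 \<longrightarrow>
            (\<exists>I_star. (I \<longlongrightarrow> I_star) at_top \<and>
               (I_star < 0 \<longrightarrow> large_orbits n S ((2 * real n + 1 - real m) / (2 * real n + 2 - real m))) \<and>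
               (I_star > 0 \<longrightarrow> large_orbits n S_inv ((2 * real n + 1 - real m) / (2 * real n + 2 - real m))) \<and>
               (I_star = 0 \<longrightarrow>
                  (a (2 * j_a) > 0 \<longrightarrow> large_orbits n S ((real m - 2 * real j_a) / (real m + 1 - 2 * real j_a))) \<and>
                  (a (2 * j_a) < 0 \<longrightarrow> large_orbits n S_inv ((real m - 2 * real j_a) / (real m + 1 - 2 * real j_a)))))))
     \<and>
     ((j_a_defined \<and> j_b_defined \<and> int n - 2 * int j_b = int m - 2 * int j_a) \<and> C \<noteq> 0 \<longrightarrow>
         (int m - int n - 2 * int j_b - 1 < 0 \<longrightarrow>
            (C > 0 \<longrightarrow>
               filterlim I at_bot at_top \<and> large_orbits_mono n S ((real n - 2 * real j_b) / (real n + 1 - 2 * real j_b))) \<and>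
            (C < 0 \<longrightarrow>
               filterlim I at_top at_top \<and> large_orbits_mono n S_inv ((real n - 2 * real j_b) / (real n + 1 - 2 * real j_b)))) \<and>
         (int m - int n - 2 * int j_b - 1 > 0 \<longrightarrow>
            (\<exists>I_star. (I \<longlongrightarrow> I_star) at_top \<and>
               (I_star < 0 \<longrightarrow> large_orbits n S ((2 * real n + 1 - real m) / (2 * real n + 2 - real m))) \<and>
               (I_star > 0 \<longrightarrow> large_orbits n S_inv ((2 * real n + 1 - real m) / (2 * real n + 2 - real m))) \<and>
               (I_star = 0 \<longrightarrow>
                  (C < 0 \<longrightarrow> large_orbits n S ((real n - 2 * real j_b) / (real n + 1 - 2 * real j_b))) \<and>
                  (C > 0 \<longrightarrow> large_orbits n S_inv ((real n - 2 * real j_b) / (real n + 1 - 2 * real j_b)))))))"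
proof -
  have mn: "1 \<le> m" "1 \<le> n" "m < 2 * n + 1"
    and adm: "lienard_normalized m n A" "lienard_admissible (lienard_F n b) (lienard_G m A a)"
    using assms(1-3,6,15) by (simp_all only: F G)
  have odd: "odd n" "odd m"
    using lienard_odd_degrees[OF mn(1,2) adm mn(3)] by auto
  note orbits = lienard_orbits[OF mn adm, folded F G, folded I S S_inv]
  have fin: "finite (even_indices m a)" "finite (odd_indices n b)"
    by (rule finite_subset[of _ "{..m}"], auto simp: even_indices_def)
       (rule finite_subset[of _ "{..n}"], auto simp: odd_indices_def)
  have ja: "a (2 * j_a) \<noteq> 0 \<and> 2 * j_a + 1 \<le> m" if j_a_defined
    using Max_in[OF fin(1)] that j_a j_a_defined by (auto simp: even_indices_def)
  have ja_max: "j_a_defined \<and> i \<le> 2 * j_a" if "even i" "i < m" "a i \<noteq> 0" for i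
  proof -
    from that have "i div 2 \<in> even_indices m a" by (auto simp: even_indices_def)
    hence "j_a_defined" "i div 2 \<le> j_a" using Max_ge[OF fin(1)] j_a j_a_defined by auto
    thus ?thesis using that by auto
  qed
  have jb: "b (2 * j_b + 1) \<noteq> 0 \<and> 2 * j_b + 1 \<le> n" if j_b_defined
    using Max_in[OF fin(2)] that j_b j_b_defined by (auto simp: odd_indices_def)
  have jb_max: "j_b_defined \<and> i \<le> 2 * j_b + 1" if "odd i" "i \<le> n" "b i \<noteq> 0" for i
  proof -
    from that have "i div 2 \<in> odd_indices n b" by (auto simp: odd_indices_def)
    hence "j_b_defined" "i div 2 \<le> j_b" using Max_ge[OF fin(2)] j_b j_b_defined by auto
    thus ?thesis using that by auto
  qed
  have lom: "large_orbits_mono n T d \<Longrightarrow> large_orbits n T d" for T d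
    by (rule large_orbits_mono_imp_large_orbits)
  show ?thesis
  proof ((intro conjI; rule impI), goal_cases)
    case 1
    have def: j_b_defined and less: "j_a_defined \<Longrightarrow> n + 2 * j_a < m + 2 * j_b"
      using 1 \<open>j_a_defined \<or> j_b_defined\<close> by auto
    obtain k where nk: "n = k + 2 * j_b" using jb[OF def] by (metis add.commute add_leD1 le_iff_add)
    have k: "odd k" using odd nk by simp
    have B0: "\<forall>i. odd i \<and> i \<le> n \<and> n + 1 < i + k \<longrightarrow> b i = 0"
      using jb_max nk by fastforce
    \<comment> \<open>The non-strict \<open>m \<le> i + k\<close> matters: the even terms of G are
      of smaller relative order than the leading odd term of F, so a (m - k) vanishes as well and c
      consists of its b part.\<close>
    have A0': "a i = 0" if "even i" "i < m" "m \<le> i + k" for i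
      using ja_max[OF that(1,2)] less that nk by linarith
    hence A0: "\<forall>i. even i \<and> i < m \<and> m < i + k \<longrightarrow> a i = 0" by simp
    define \<beta> where "\<beta> = b (2 * j_b + 1)"
    define c where "c = \<beta> * (real m - real n + 2 * real j_b + 1)"
    have "k \<le> m \<Longrightarrow> a (m - k) = 0" using A0'[of "m - k"] odd k by (cases k) auto
    hence "c = (if k \<le> n then b (n + 1 - k) else 0) * (real m + 1 - real k) -
        (if k \<le> m then a (m - k) else 0) * (real n + 1)"
      by (simp add: c_def \<beta>_def nk)
    note O = orbits[OF k B0 A0 this]
    \<comment> \<open>The condition says n + 1 + 2 j_b < m, so the factor m - n + 2 j_b + 1 is
      positive and c has the sign of b.\<close>
    have sc: "c \<noteq> 0 \<and> (c < 0 \<longleftrightarrow> \<beta> < 0) \<and> (c > 0 \<longleftrightarrow> \<beta> > 0)" if "2 * n + 1 < k + m"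
      using that jb[OF def] nk by (auto simp: c_def \<beta>_def zero_less_mult_iff mult_less_0_iff)
    have dim: "(real n - 2 * real j_b) / (real n + 1 - 2 * real j_b) = real k / (real k + 1)"
      by (simp add: nk)
    have sgn: "int m - int n - 2 * int j_b - 1 < 0 \<longleftrightarrow> k + m < 2 * n + 1"
      "int m - int n - 2 * int j_b - 1 > 0 \<longleftrightarrow> 2 * n + 1 < k + m"
      using nk by auto
    show ?case unfolding dim sgn \<beta>_def[symmetric] c_def[symmetric]
      by (intro conjI impI) (use O sc lom in auto)
  next
    case 2
    have def: j_a_defined and less: "j_b_defined \<Longrightarrow> m + 2 * j_b < n + 2 * j_a"
      using 2 \<open>j_a_defined \<or> j_b_defined\<close> by auto
    obtain k where mk: "m = k + 2 * j_a" using ja[OF def] by (metis add.commute add_leD1 le_iff_add)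
    have k: "odd k" using odd mk by simp
    \<comment> \<open>Mirror image of the previous case: now b (n + 1 - k) vanishes too, and c = -a
      (n + 1) reverses the sign conditions.\<close>
    have B0': "b i = 0" if "odd i" "i \<le> n" "n + 1 \<le> i + k" for i
      using jb_max[OF that(1,2)] less that mk by linarith
    hence B0: "\<forall>i. odd i \<and> i \<le> n \<and> n + 1 < i + k \<longrightarrow> b i = 0" by simp
    have A0: "\<forall>i. even i \<and> i < m \<and> m < i + k \<longrightarrow> a i = 0"
      using ja_max mk by fastforce
    define \<alpha> where "\<alpha> = a (2 * j_a)"
    define c where "c = - \<alpha> * (real n + 1)"
    have "k \<le> n \<Longrightarrow> b (n + 1 - k) = 0" using B0'[of "n + 1 - k"] odd k by (cases k) auto
    hence "c = (if k \<le> n then b (n + 1 - k) else 0) * (real m + 1 - real k) -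
        (if k \<le> m then a (m - k) else 0) * (real n + 1)"
      by (simp add: c_def \<alpha>_def mk)
    note O = orbits[OF k B0 A0 this]
    have sc: "c \<noteq> 0" "c < 0 \<longleftrightarrow> \<alpha> > 0" "c > 0 \<longleftrightarrow> \<alpha> < 0"
      using ja[OF def] by (auto simp: c_def \<alpha>_def zero_less_mult_iff mult_less_0_iff)
    have dim: "(real m - 2 * real j_a) / (real m + 1 - 2 * real j_a) = real k / (real k + 1)"
      by (simp add: mk)
    have sgn: "2 * int m - 2 * int n - 2 * int j_a - 1 < 0 \<longleftrightarrow> k + m < 2 * n + 1"
      "2 * int m - 2 * int n - 2 * int j_a - 1 > 0 \<longleftrightarrow> 2 * n + 1 < k + m"
      using mk by auto
    show ?case unfolding dim sgn \<alpha>_def[symmetric]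
      by (intro conjI impI) (use O(1,2) O(3)[OF _ sc(1)] lom in \<open>auto simp: sc\<close>)
  next
    case 3
    hence def: j_a_defined j_b_defined and eq: "n + 2 * j_a = m + 2 * j_b" and C0: "C \<noteq> 0" by auto
    obtain k where nk: "n = k + 2 * j_b" using jb[OF def(2)] by (metis add.commute add_leD1 le_iff_add)
    \<comment> \<open>Both asymmetries have the same order k, so both terms survive and c is
      \<open>C\<close>; its being nonzero excludes cancellation.\<close>
    have mk: "m = k + 2 * j_a" using eq nk by simp
    have k: "odd k" using odd nk by simp
    have B0: "\<forall>i. odd i \<and> i \<le> n \<and> n + 1 < i + k \<longrightarrow> b i = 0"
      using jb_max nk by fastforce
    have A0: "\<forall>i. even i \<and> i < m \<and> m < i + k \<longrightarrow> a i = 0"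
      using ja_max mk by fastforce
    have "C = (if k \<le> n then b (n + 1 - k) else 0) * (real m + 1 - real k) -
        (if k \<le> m then a (m - k) else 0) * (real n + 1)"
      by (simp add: C nk mk)
    note O = orbits[OF k B0 A0 this]
    have dim: "(real n - 2 * real j_b) / (real n + 1 - 2 * real j_b) = real k / (real k + 1)"
      by (simp add: nk)
    have sgn: "int m - int n - 2 * int j_b - 1 < 0 \<longleftrightarrow> k + m < 2 * n + 1"
      "int m - int n - 2 * int j_b - 1 > 0 \<longleftrightarrow> 2 * n + 1 < k + m"
      using nk by auto
    show ?case unfolding dim sgn
      by (intro conjI impI) (use O(1,2) O(3)[OF _ C0] in auto)
  qed
qed

end
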